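(* Let $\mu=(\alpha_1,\ldots,\alpha_n\,|\,\beta_1,\ldots,\beta_n)$ be a partition in Frobenius notation, and set $$A=(a_1,\ldots,a_n):=(\alpha_1+1,\ldots,\alpha_n+1),\quad B:=(\beta_1,\ldots,\beta_n),$$ $$C=(c_1,\ldots,c_n):=(\beta_1+1,\ldots,\beta_n+1),\quad D:=(\alpha_1,\ldots,\alpha_n).$$ Then $$ \sum Q_{(a_{i_1},\ldots,a_{i_k})}\cdot Q_{A\# B\smallsetminus (a_{i_1},\ldots,a_{i_k})} =\sum Q_{(c_{i_1},\ldots,c_{i_k})}\cdot Q_{C\# D\smallsetminus (c_{i_1},\ldots,c_{i_k})}, $$ where both sums are over all sequences $1\le i_1<\cdots<i_k\le n$ and $k=0,1,\ldots,n$.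
   Context: Frobenius notation: $\alpha_1>\cdots>\alpha_n\ge 0$ and $\beta_1>\cdots>\beta_n\ge0$, where $n$ is the length of the main diagonal of the diagram of $\mu$, $\alpha_j=\mu_j-j$ and $\beta_j=\mu^{\sim}_j-j$, with $\mu^{\sim}$ the conjugate partition. For sequences $X=(x_1,\ldots,x_n)$ and $Y=(y_1,\ldots,y_n)$, $X\#Y$ denotes the interleaved sequence $(x_1,y_1,x_2,y_2,\ldots,x_n,y_n)$, and $X\#Y\smallsetminus(x_{i_1},\ldots,x_{i_k})$ is the sequence obtained from $X\#Y$ by deleting the entries coming from $X$ with indices $i_1,\ldots,i_k$ (keeping the order of the remaining entries). $Q$-functions: the symmetric functions $Q_j$ are defined by $\sum_{j\ge0}Q_jt^j=\prod_{r}\frac{1+x_rt}{1-x_rt}$; for $k>l\ge 0$, $Q_{(k,l)}:=Q_kQ_l+2\sum_{p=1}^{l}(-1)^pQ_{k+p}Q_{l-p}$; and for a strict partition $\lambda=(\lambda_1>\cdots>\lambda_{r}\ge 0)$ with $r$ even (adding one part $0$ if necessary), $Q_\lambda$ is the Pfaffian of the antisymmetric $r\times r$ matrix with entries $Q_{(\lambda_p,\lambda_q)}$ for $p<q$; $Q_\emptyset=1$ (these are Schur's $Q$-functions). For an arbitrary sequence $K$ of nonnegative integers occurring in the statement: if $K$ has a final entry $0$ it is dropped (a zero can only occur as the last entry); if $K$ then has two equal entries, $Q_K:=0$; otherwise $Q_K:=\operatorname{sgn}(w)\,Q_{\langle K\rangle}$, where $\langle K\rangle$ is the strict partition obtained by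 rearranging $K=(k_1,\ldots,k_l)$ in decreasing order and $w\in S_l$ is the permutation with $k_{w(1)}>\cdots>k_{w(l)}$. *)

theory Defs
  imports
    Complex_Main
    "HOL-Library.Multiset"
    "HOL-Combinatorics.Permutations"
    "HOL-Computational_Algebra.Formal_Power_Series"
begin

text \<open>
  The ring of symmetric functions in infinitely many variables \<open>x\<^sub>0, x\<^sub>1, \<dots>\<close> lives inside the ring of
  formal power series in these variables. A monomial is encoded as the multiset of the indices of
  its variables, so a power series is an arbitrary coefficient function on multisets, and the
  product is the Cauchy product (a finite sum, as a multiset has finitely many submultisets).
\<close>

typedef 'a mps = "UNIV :: (nat multiset \<Rightarrow> 'a) set"
  morphisms mps_coeff Abs_mps ..

lemma mps_coeff_Abs [simp]: "mps_coeff (Abs_mps f) = f"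
  by (simp add: Abs_mps_inverse)

lemma mps_eqI: "(\<And>m. mps_coeff f m = mps_coeff g m) \<Longrightarrow> f = g"
  by (metis mps_coeff_inverse ext)

definition mset_splits :: "'b multiset \<Rightarrow> ('b multiset \<times> 'b multiset) set" where
  "mset_splits m = {(p, q). p + q = m}"

lemma finite_mset_splits [simp]:
  fixes m :: "'b multiset"
  shows "finite (mset_splits m)"
proof (induction m)
  case empty
  have "mset_splits ({#} :: 'b multiset) = {({#}, {#})}"
    by (auto simp: mset_splits_def)
  then show ?case by simp
next
  case (add x m)
  let ?S = "(\<lambda>u. (add_mset x (fst u), snd u)) ` mset_splits m \<union>
            (\<lambda>u. (fst u, add_mset x (snd u))) ` mset_splits m"
  have "u \<in> ?S" if "u \<in> mset_splits (add_mset x m)" for u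
  proof -
    obtain p q where u: "u = (p, q)" by (cases u)
    have e: "p + q = add_mset x m"
      using that by (simp add: u mset_splits_def)
    then have "x \<in># p + q" by simp
    then consider "x \<in># p" | "x \<in># q" by auto
    then show ?thesis
    proof cases
      case 1
      then obtain p' where p': "p = add_mset x p'"
        by (meson mset_add)
      with e have "(p', q) \<in> mset_splits m"
        by (simp add: mset_splits_def)
      then show ?thesis
        unfolding u p' by (intro UnI1 image_eqI [where x = "(p', q)"]) simp_all
    next
      case 2
      then obtain q' where q': "q = add_mset x q'"
        by (meson mset_add)
      with e have "(p, q') \<in> mset_splits m"
        by (simp add: mset_splits_def)
      then show ?thesis
        unfolding u q' by (intro UnI2 image_eqI [where x = "(p, q')"]) simp_all
    qed
  qed
  then have "mset_splits (add_mset x m) \<subseteq> ?S"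
    by (rule subsetI)
  then show ?case
    using add.IH by (meson finite_UnI finite_imageI finite_subset)
qed

instantiation mps :: (comm_ring_1) comm_ring_1
begin

definition "0 = Abs_mps (\<lambda>_. 0)"
definition "1 = Abs_mps (\<lambda>m. if m = {#} then 1 else 0)"
definition "f + g = Abs_mps (\<lambda>m. mps_coeff f m + mps_coeff g m)"
definition "f - g = Abs_mps (\<lambda>m. mps_coeff f m - mps_coeff g m)"
definition "- f = Abs_mps (\<lambda>m. - mps_coeff f m)"
definition "f * g = Abs_mps (\<lambda>m. \<Sum>(p, q)\<in>mset_splits m. mps_coeff f p * mps_coeff g q)"

instance
proof
  fix a b c :: "'a mps"
  show "a * b * c = a * (b * c)"
  proof (rule mps_eqI)
    fix m
    let ?f = "mps_coeff a" and ?g = "mps_coeff b" and ?h = "mps_coeff c"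
    have "mps_coeff (a * b * c) m =
        (\<Sum>u\<in>mset_splits m. \<Sum>v\<in>mset_splits (fst u). ?f (fst v) * ?g (snd v) * ?h (snd u))"
      by (simp add: times_mps_def case_prod_beta sum_distrib_right)
    also have "\<dots> = (\<Sum>(u, v)\<in>Sigma (mset_splits m) (\<lambda>u. mset_splits (fst u)).
        ?f (fst v) * ?g (snd v) * ?h (snd u))"
      by (rule sum.Sigma) auto
    also have "\<dots> = (\<Sum>(u, v)\<in>Sigma (mset_splits m) (\<lambda>u. mset_splits (snd u)).
        ?f (fst u) * (?g (fst v) * ?h (snd v)))"
      by (rule sum.reindex_bij_witness
            [where i = "\<lambda>(u, v). ((fst u + fst v, snd v), (fst u, fst v))"
              and j = "\<lambda>(u, v). ((fst v, snd v + snd u), (snd v, snd u))"])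
        (auto simp: mset_splits_def mult.assoc add.assoc)
    also have "\<dots> = (\<Sum>u\<in>mset_splits m. \<Sum>v\<in>mset_splits (snd u). ?f (fst u) * (?g (fst v) * ?h (snd v)))"
      by (rule sum.Sigma [symmetric]) auto
    also have "\<dots> = mps_coeff (a * (b * c)) m"
      by (simp add: times_mps_def case_prod_beta sum_distrib_left)
    finally show "mps_coeff (a * b * c) m = mps_coeff (a * (b * c)) m" .
  qed
  show "a * b = b * a"
    unfolding times_mps_def
    by (intro arg_cong [where f = Abs_mps] ext,
        rule sum.reindex_bij_witness [where i = prod.swap and j = prod.swap])
      (auto simp: mset_splits_def ac_simps)
  show "1 * a = a"
  proof (rule mps_eqI)
    fix m
    have "mps_coeff (1 * a) m
        = (\<Sum>(p, q)\<in>mset_splits m. (if p = {#} then 1 else 0) * mps_coeff a q)"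
      by (simp add: times_mps_def one_mps_def)
    also have "\<dots> = (\<Sum>(p, q)\<in>{({#} :: nat multiset, m)}. (if p = {#} then 1 else 0) * mps_coeff a q)"
      by (rule sum.mono_neutral_right [OF finite_mset_splits])
        (auto simp: mset_splits_def split: if_splits)
    finally show "mps_coeff (1 * a) m = mps_coeff a m" by simp
  qed
  show "(a + b) * c = a * c + b * c"
    by (rule mps_eqI)
      (simp add: times_mps_def plus_mps_def case_prod_beta distrib_right sum.distrib)
  show "(0 :: 'a mps) \<noteq> 1"
  proof
    assume "(0 :: 'a mps) = 1"
    then have "mps_coeff (0 :: 'a mps) {#} = mps_coeff 1 {#}" by simp
    then show False by (simp add: zero_mps_def one_mps_def)
  qed
qed (auto intro!: mps_eqI simp: zero_mps_def plus_mps_def minus_mps_def uminus_mps_def algebra_simps)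

end

definition mps_var :: "nat \<Rightarrow> 'a::comm_ring_1 mps" where
  "mps_var r = Abs_mps (\<lambda>m. if m = {#r#} then 1 else 0)"

text \<open>
  The series \<open>(1 + x\<^sub>r t) / (1 - x\<^sub>r t)\<close> in the variable \<open>t\<close>, given by \<^const>\<open>fps_X\<close>. The second
  argument of \<^term>\<open>fps_right_inverse\<close> is the inverse of the constant term \<open>1\<close>.
\<close>

definition Q_factor :: "nat \<Rightarrow> int mps fps" where
  "Q_factor r = (1 + fps_const (mps_var r) * fps_X) *
     fps_right_inverse (1 - fps_const (mps_var r) * fps_X) 1"

text \<open>
  The infinite product over all \<open>r\<close> is the coefficientwise limit of the finite partial products.
  The limit is taken in the discrete space of integers, and \<open>eventually_Q_fun\<close> below shows that
  it exists, that is, that the sequence of coefficients is eventually constant.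
\<close>

definition Q_fun :: "nat \<Rightarrow> int mps" where
  "Q_fun j = Abs_mps (\<lambda>m. lim (\<lambda>N. mps_coeff (fps_nth (\<Prod>r<N. Q_factor r) j) m))"

lemma mps_coeff_var_mult:
  assumes "r \<notin># m"
  shows "mps_coeff (mps_var r * f) m = 0"
  unfolding times_mps_def mps_var_def
  using assms by (auto simp: mset_splits_def intro!: sum.neutral)

lemma Q_factor_inverse:
  "(1 - fps_const (mps_var r) * fps_X) * Q_factor r = 1 + fps_const (mps_var r) * fps_X"
proof -
  let ?g = "1 - fps_const (mps_var r :: int mps) * fps_X"
  have "?g * fps_right_inverse ?g 1 = 1"
    by (rule fps_right_inverse) simp
  then have inv: "h * (?g * fps_right_inverse ?g 1) = h" for h
    by simp
  show ?thesis
    unfolding Q_factor_def by (subst mult.left_commute) (rule inv)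
qed

lemma eventually_Q_fun:
  "eventually (\<lambda>N. mps_coeff (fps_nth (\<Prod>r<N. Q_factor r) j) m = mps_coeff (Q_fun j) m) sequentially"
proof -
  define c where "c N = mps_coeff (fps_nth (\<Prod>r<N. Q_factor r) j) m" for N
  have c_Suc: "c (Suc N) = c N" if "N \<notin># m" for N
  proof -
    let ?x = "fps_const (mps_var N :: int mps)" and ?P = "\<Prod>r<N. Q_factor r"
    have "Q_factor N = 1 + ?x * (fps_X * (1 + Q_factor N))"
      using Q_factor_inverse [of N] by (simp add: algebra_simps)
    then have "(\<Prod>r<Suc N. Q_factor r) = ?P + ?x * (fps_X * (1 + Q_factor N) * ?P)"
      by (metis (no_types, lifting) distrib_left lessThan_Suc mult.assoc mult.commute
          mult.right_neutral prod.lessThan_Suc)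
    then have "fps_nth (\<Prod>r<Suc N. Q_factor r) j
        = fps_nth ?P j + mps_var N * fps_nth (fps_X * (1 + Q_factor N) * ?P) j"
      by (metis fps_add_nth fps_mult_left_const_nth)
    then show ?thesis
      unfolding c_def by (simp add: plus_mps_def mps_coeff_var_mult [OF that])
  qed
  obtain N0 where N0: "\<forall>r\<in>#m. r < N0"
    by (metis finite_nat_set_iff_bounded finite_set_mset)
  have "c N = c N0" if "N \<ge> N0" for N
    using that
  proof (induction N rule: dec_induct)
    case (step n)
    then have "n \<notin># m" using N0 by force
    then show ?case using c_Suc step.IH by simp
  qed simp
  then have ev: "eventually (\<lambda>N. c N = c N0) sequentially"
    using eventually_ge_at_top [of N0] by (rule eventually_mono [rotated])
  then have "c \<longlonglongrightarrow> c N0"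
    by (rule tendsto_eventually)
  then have "mps_coeff (Q_fun j) m = c N0"
    unfolding Q_fun_def c_def by (simp add: limI)
  with ev show ?thesis
    unfolding c_def by simp
qed

definition Q_pair :: "nat \<Rightarrow> nat \<Rightarrow> int mps" where
  "Q_pair k l = Q_fun k * Q_fun l + 2 * (\<Sum>p=1..l. (-1) ^ p * Q_fun (k + p) * Q_fun (l - p))"

text \<open>
  The Pfaffian of a \<open>2n \<times> 2n\<close> matrix as the signed sum over perfect matchings, each matching
  \<open>{{w 0, w 1}, {w 2, w 3}, \<dots>}\<close> being represented by its unique normalised permutation \<open>w\<close>.
\<close>

definition pfaffian :: "nat \<Rightarrow> (nat \<Rightarrow> nat \<Rightarrow> 'a::comm_ring_1) \<Rightarrow> 'a" where
  "pfaffian n M = (\<Sum>w | w permutes {..<2 * n} \<and>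
       (\<forall>i<n. w (2 * i) < w (2 * i + 1)) \<and> (\<forall>j<n. \<forall>i<j. w (2 * i) < w (2 * j)).
     of_int (sign w) * (\<Prod>i<n. M (w (2 * i)) (w (2 * i + 1))))"

definition Q_strict :: "nat list \<Rightarrow> int mps" where
  "Q_strict L =
    (let L' = (if even (length L) then L else L @ [0])
     in pfaffian (length L' div 2)
          (\<lambda>p q. if p < q then Q_pair (L' ! p) (L' ! q)
                 else if q < p then - Q_pair (L' ! q) (L' ! p)
                 else 0))"

definition sorting_perm :: "nat list \<Rightarrow> nat \<Rightarrow> nat" where
  "sorting_perm K = (THE w. w permutes {..<length K} \<and>
     (\<forall>j<length K. \<forall>i<j. K ! w i > K ! w j))"

definition drop_final_zero :: "nat list \<Rightarrow> nat list" where
  "drop_final_zero K = (if K \<noteq> [] \<and> last K = 0 then butlast K else K)"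

definition Q_seq :: "nat list \<Rightarrow> int mps" where
  "Q_seq K =
    (let L = drop_final_zero K; w = sorting_perm L
     in if distinct L
        then of_int (sign w) * Q_strict (map (\<lambda>i. L ! w i) [0..<length L])
        else 0)"

definition is_partition :: "nat list \<Rightarrow> bool" where
  "is_partition \<mu> \<longleftrightarrow> sorted_wrt (\<ge>) \<mu> \<and> 0 \<notin> set \<mu>"

definition diagram :: "nat list \<Rightarrow> (nat \<times> nat) set" where
  "diagram \<mu> = {(i, j). i < length \<mu> \<and> j < \<mu> ! i}"

text \<open>Column length of the diagram: with 0-based indices, part \<open>j\<close> of the conjugate partition.\<close>

definition conj_part :: "nat list \<Rightarrow> nat \<Rightarrow> nat" where
  "conj_part \<mu> j = card {i. (i, j) \<in> diagram \<mu>}"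

definition diag_length :: "nat list \<Rightarrow> nat" where
  "diag_length \<mu> = card {i. (i, i) \<in> diagram \<mu>}"

text \<open>
  As indices start at 0, the formula \<open>\<alpha>\<^sub>j = \<mu>\<^sub>j - j\<close> becomes \<open>\<mu> ! j - (j + 1)\<close>. The subtraction
  does not truncate for indices \<open>j\<close> on the diagonal, and likewise for \<open>\<beta>\<^sub>j\<close>.
\<close>

definition frob_alpha :: "nat list \<Rightarrow> nat list" where
  "frob_alpha \<mu> = map (\<lambda>j. \<mu> ! j - (j + 1)) [0..<diag_length \<mu>]"

definition frob_beta :: "nat list \<Rightarrow> nat list" where
  "frob_beta \<mu> = map (\<lambda>j. conj_part \<mu> j - (j + 1)) [0..<diag_length \<mu>]"

text \<open>
  For lists \<open>X\<close>, \<open>Y\<close> of equal length, \<^term>\<open>splice X Y\<close> is \<open>[x\<^sub>0, y\<^sub>0, x\<^sub>1, y\<^sub>1, \<dots>]\<close>, and the entry of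
  \<open>X\<close> with index \<open>i\<close> stands at position \<open>2i\<close>.
\<close>

definition interleave_minus :: "'b list \<Rightarrow> 'b list \<Rightarrow> nat set \<Rightarrow> 'b list" where
  "interleave_minus X Y I = nths (splice X Y) (- ((\<lambda>i. 2 * i) ` I))"

end

theory Submission
  imports Defs "Jordan_Normal_Form.Determinant"
begin

text \<open>
  Extend $Q_{(k,l)}$ to an antisymmetric kernel on all pairs of numbers, and attach to a sequence
  $K$ the Pfaffian of this kernel on $K$ if $K$ has even length, and the Pfaffian bordered by the
  column of the $Q_k$ if it has odd length. Pfaffians alternate, so this is $Q_K$ with all its
  conventions about rearrangement, repeated entries and a final zero
  (\<open>Q_seq_bordered_pf\<close>).

  The left-hand side is thus a sum of products of two Pfaffians over all ways to take some entries
  of $A$ out of $A\#B$. Taking $k$ entries out of the odd positions costs the sign $(-1)^{\lfloor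
  k/2\rfloor}$, which is also what the change of the kernel into its negative does to the first
  Pfaffian. Hence the sum over even $k$ has the form $\sum
  \pm\,\mathrm{Pf}(N_I)\,\mathrm{Pf}(M_{I^c})$, with $M$ the kernel $Q_{(k,l)}$ and $N$ the
  restriction of $-M$ to $A\times A$, and equals $\mathrm{Pf}(M+N)$, the expansion of the Pfaffian
  of a sum of matrices (\<open>pf_add\<close>). The terms with odd $k$ add the matrix $u\wedge v$
  of rank two, where $v$ is the column of all $Q_k$ and $u$ its restriction to $A$
  (\<open>pf_rank_two_update\<close>). The left-hand side is therefore a single Pfaffian
  (\<open>wedge_restricted_bordered_pf\<close>). Its matrix vanishes on $A\times A$ and has the
  entries $Q_{(a,b)}+Q_aQ_b$ on $A\times B$. Because there are as many entries in $A$ as in $B$,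
  every perfect matching that avoids $A\times A$ also avoids $B\times B$, so that only the block
  $A\times B$ matters: the Pfaffian is the determinant of the matrix
  $(Q_{(a_i,b_j)}+Q_{a_i}Q_{b_j})$.

  The formula for $Q_{(a,b)}$ gives $Q_{(a,b)}+Q_aQ_b = 2\sum_{p=0}^{b}(-1)^pQ_{a+p}Q_{b-p}$. With
  $a=\alpha_i+1$ and $b=\beta_j$ this is symmetric in $\alpha_i$ and $\beta_j$, because $\sum_j
  Q_jt^j$ and $\sum_j Q_j(-t)^j$ are inverse to each other (\<open>Q_tail_symmetric\<close>). The
  right-hand side is the same determinant with $\alpha$ and $\beta$ exchanged, that is, transposed
  (\<open>pf_cross_kernel_transpose\<close>).

  Signs are handled by exterior algebra. A function on lists is read as a multilinear form that is
  evaluated on a sequence of vectors, and the signed sum over all ways to split a list into two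
  complementary subsequences is the exterior product of two forms. The Pfaffian then is the
  solution of a first-order equation (\<open>pf_Cons\<close>, \<open>pf_unique\<close>), and the
  formulas for sums of kernels hold because both sides solve the same equation.
\<close>

section \<open>Forms on lists and their exterior product\<close>

text \<open>
  The exterior product of a covector with a form. The recursion on the first argument is the
  Leibniz rule for the contraction of the product with that argument.
\<close>

fun wedge1 :: "('a \<Rightarrow> 'r::comm_ring_1) \<Rightarrow> ('a list \<Rightarrow> 'r) \<Rightarrow> 'a list \<Rightarrow> 'r" where
  "wedge1 u f [] = 0"
| "wedge1 u f (x # xs) = u x * f xs - wedge1 u (\<lambda>l. f (x # l)) xs"

text \<open>
  The sign picked up when a single vector is moved past the arguments of a form.
\<close>

definition grade_sign :: "('a list \<Rightarrow> 'r::comm_ring_1) \<Rightarrow> 'a list \<Rightarrow> 'r" where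
  "grade_sign f = (\<lambda>l. (-1) ^ length l * f l)"

text \<open>
  The exterior product as a signed shuffle product: the first vector goes to one of the two
  factors, and if it goes to the second one, it has to pass the arguments of the first.
\<close>

fun wedge :: "('a list \<Rightarrow> 'r::comm_ring_1) \<Rightarrow> ('a list \<Rightarrow> 'r) \<Rightarrow> 'a list \<Rightarrow> 'r" where
  "wedge f g [] = f [] * g []"
| "wedge f g (x # xs) =
     wedge (\<lambda>l. f (x # l)) g xs + wedge (grade_sign f) (\<lambda>l. g (x # l)) xs"

text \<open>
  In the product with a covector the form is only evaluated on lists that are one shorter, which
  makes induction on the length of a list possible.
\<close>

lemma wedge1_cong:
  assumes "\<And>l. Suc (length l) = length xs \<Longrightarrow> f l = g l"
  shows "wedge1 u f xs = wedge1 u g xs"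
  using assms
proof (induction xs arbitrary: f g)
  case (Cons x xs)
  have "wedge1 u (\<lambda>l. f (x # l)) xs = wedge1 u (\<lambda>l. g (x # l)) xs"
    by (rule Cons.IH) (use Cons.prems in simp)
  then show ?case using Cons.prems by simp
qed simp

lemma wedge1_add_form: "wedge1 u (\<lambda>l. f l + g l) xs = wedge1 u f xs + wedge1 u g xs"
  by (induction xs arbitrary: f g) (simp_all add: algebra_simps)

lemma wedge1_scale_form: "wedge1 u (\<lambda>l. c * f l) xs = c * wedge1 u f xs"
  by (induction xs arbitrary: f) (simp_all add: algebra_simps)

lemma wedge1_minus_form: "wedge1 u (\<lambda>l. - f l) xs = - wedge1 u f xs"
  using wedge1_scale_form [of u "-1" f xs] by simp

lemma wedge1_diff_form: "wedge1 u (\<lambda>l. f l - g l) xs = wedge1 u f xs - wedge1 u g xs"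
  by (induction xs arbitrary: f g) (simp_all add: algebra_simps)

lemma wedge1_add: "wedge1 (\<lambda>x. u x + w x) f xs = wedge1 u f xs + wedge1 w f xs"
  by (induction xs arbitrary: f) (simp_all add: algebra_simps)

lemma wedge1_scale: "wedge1 (\<lambda>x. c * u x) f xs = c * wedge1 u f xs"
  by (induction xs arbitrary: f) (simp_all add: algebra_simps)

lemma wedge1_minus: "wedge1 (\<lambda>x. - u x) f xs = - wedge1 u f xs"
  using wedge1_scale [of "-1" u f xs] by simp

lemma wedge1_zero_form [simp]: "wedge1 u (\<lambda>_. 0) xs = 0"
  by (induction xs) simp_all

text \<open>
  The link between the recursive product and the expansion of a Pfaffian along a row.
\<close>

lemma wedge1_sum:
  "wedge1 u f xs = (\<Sum>j<length xs. (-1) ^ j * u (xs ! j) * f (take j xs @ drop (Suc j) xs))"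
proof (induction xs arbitrary: f)
  case (Cons x xs)
  then show ?case
    by (simp add: sum.lessThan_Suc_shift sum_negf del: sum.lessThan_Suc)
qed simp

lemma wedge1_append_single:
  assumes "\<And>x. x \<in> set xs \<Longrightarrow> u x = 0"
  shows "wedge1 u f (xs @ [z]) = (-1) ^ length xs * u z * f xs"
  using assms by (induction xs arbitrary: f) auto

lemma wedge1_eq_0: "(\<And>x. x \<in> set xs \<Longrightarrow> u x = 0) \<Longrightarrow> wedge1 u f xs = 0"
  by (induction xs arbitrary: f) auto

lemma wedge1_anticommute: "wedge1 u (wedge1 w f) xs = - wedge1 w (wedge1 u f) xs"
  by (induction xs arbitrary: f) (simp_all add: wedge1_diff_form wedge1_scale_form)

lemma wedge1_self: "wedge1 u (wedge1 u f) xs = 0"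
  by (induction xs arbitrary: f) (simp_all add: wedge1_diff_form wedge1_scale_form)

text \<open>
  A factor that depends only on the degree of the form commutes with the product up to a shift of
  the degree. This applies to \<^const>\<open>grade_sign\<close> and to the sign in
  \<open>restrict_form\<close> below.
\<close>

lemma wedge1_graded:
  "wedge1 u (\<lambda>l. s (length l) * f l) xs = s (length xs - 1) * wedge1 u f xs"
proof -
  have "wedge1 u (\<lambda>l. s (length l) * f l) xs = wedge1 u (\<lambda>l. s (length xs - 1) * f l) xs"
    by (rule wedge1_cong) (metis diff_Suc_1)
  then show ?thesis by (simp add: wedge1_scale_form)
qed

lemma wedge1_grade_sign: "wedge1 u (grade_sign f) = (\<lambda>l. - grade_sign (wedge1 u f) l)"
proof
  fix l
  show "wedge1 u (grade_sign f) l = - grade_sign (wedge1 u f) l"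
    by (cases l) (simp_all add: wedge1_graded grade_sign_def del: wedge1.simps(2))
qed

lemma grade_sign_grade_sign [simp]: "grade_sign (grade_sign f) = f"
  by (simp add: grade_sign_def mult.assoc [symmetric] power_add [symmetric])

lemma grade_sign_Cons: "(\<lambda>l. grade_sign f (x # l)) = (\<lambda>l. - grade_sign (\<lambda>l. f (x # l)) l)"
  by (simp add: grade_sign_def)

lemma wedge_add_left: "wedge (\<lambda>l. f l + f' l) g xs = wedge f g xs + wedge f' g xs"
proof (induction xs arbitrary: f f' g)
  case (Cons x xs)
  have "grade_sign (\<lambda>l. f l + f' l) = (\<lambda>l. grade_sign f l + grade_sign f' l)"
    by (simp add: grade_sign_def algebra_simps)
  then show ?case by (simp add: Cons)
qed (simp add: algebra_simps)

lemma wedge_add_right: "wedge f (\<lambda>l. g l + g' l) xs = wedge f g xs + wedge f g' xs"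
  by (induction xs arbitrary: f g g') (simp_all add: algebra_simps)

lemma wedge_scale_left: "wedge (\<lambda>l. c * f l) g xs = c * wedge f g xs"
proof (induction xs arbitrary: f g)
  case (Cons x xs)
  have "grade_sign (\<lambda>l. c * f l) = (\<lambda>l. c * grade_sign f l)"
    by (simp add: grade_sign_def algebra_simps)
  then show ?case by (simp add: Cons algebra_simps)
qed (simp add: algebra_simps)

lemma wedge_scale_right: "wedge f (\<lambda>l. c * g l) xs = c * wedge f g xs"
  by (induction xs arbitrary: f g) (simp_all add: algebra_simps)

lemma wedge_minus_left: "wedge (\<lambda>l. - f l) g xs = - wedge f g xs"
  using wedge_scale_left [of "-1" f g xs] by simp

lemma wedge_diff_left: "wedge (\<lambda>l. f l - f' l) g xs = wedge f g xs - wedge f' g xs"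
  using wedge_add_left [of f "\<lambda>l. - f' l" g xs] by (simp add: wedge_minus_left)

lemma wedge_diff_right: "wedge f (\<lambda>l. g l - g' l) xs = wedge f g xs - wedge f g' xs"
  by (induction xs arbitrary: f g g') (simp_all add: algebra_simps)

text \<open>
  Together with the next lemma this is associativity of the exterior product for a covector and
  two forms, in the two cases where the covector joins the left or the right form.
\<close>

lemma wedge1_wedge_left: "wedge1 u (wedge f g) xs = wedge (wedge1 u f) g xs"
proof (induction xs arbitrary: f g)
  case (Cons x xs)
  have "grade_sign (wedge1 u f) = (\<lambda>l. - wedge1 u (grade_sign f) l)"
    by (simp add: wedge1_grade_sign)
  then show ?case
    by (simp add: wedge1_add_form Cons wedge_diff_left wedge_scale_left wedge_minus_left)
qed simp

lemma wedge1_wedge_right: "wedge1 u (wedge f g) xs = wedge (grade_sign f) (wedge1 u g) xs"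
proof (induction xs arbitrary: f g)
  case (Cons x xs)
  then show ?case
    by (simp add: wedge1_add_form grade_sign_Cons wedge_diff_right wedge_scale_right
        wedge_minus_left
        wedge_diff_left wedge1_wedge_left)
qed simp

lemma wedge_eq_0:
  assumes "\<And>l l'. length l + length l' = length xs \<Longrightarrow> f l = 0 \<or> g l' = 0"
  shows "wedge f g xs = 0"
  using assms
proof (induction xs arbitrary: f g)
  case (Cons x xs)
  have "wedge (\<lambda>l. f (x # l)) g xs = 0"
    using Cons.prems by (intro Cons.IH) (metis add_Suc length_Cons)
  moreover have "wedge (grade_sign f) (\<lambda>l. g (x # l)) xs = 0"
    using Cons.prems
    by (intro Cons.IH) (metis add_Suc_right grade_sign_def length_Cons mult_zero_right)
  ultimately show ?case by simp
qed auto

section \<open>Expansion of the Pfaffian along its first row\<close>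

text \<open>
  The normalised representatives of the perfect matchings of the numbers below $2n$, as they occur
  in \<^const>\<open>pfaffian\<close>.
\<close>

definition matching_perms :: "nat \<Rightarrow> (nat \<Rightarrow> nat) set" where
  "matching_perms n = {w. w permutes {..<2 * n} \<and>
     (\<forall>i<n. w (2 * i) < w (2 * i + 1)) \<and> (\<forall>j<n. \<forall>i<j. w (2 * i) < w (2 * j))}"

lemma pfaffian_matching_perms:
  "pfaffian n M = (\<Sum>w\<in>matching_perms n.
     of_int (sign w) * (\<Prod>i<n. M (w (2 * i)) (w (2 * i + 1))))"
  by (simp add: pfaffian_def matching_perms_def)

lemma finite_matching_perms [simp]: "finite (matching_perms n)"
  by (rule finite_subset [OF _ finite_permutations [of "{..<2 * n}"]])
    (auto simp: matching_perms_def)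

text \<open>
  The edges of a normalised matching are listed as increasing pairs, so only the entries above the
  diagonal are used.
\<close>

lemma pfaffian_cong:
  assumes "\<And>p q. p < q \<Longrightarrow> q < 2 * n \<Longrightarrow> M p q = M' p q"
  shows "pfaffian n M = pfaffian n M'"
  unfolding pfaffian_matching_perms
proof (rule sum.cong [OF refl])
  fix w assume w: "w \<in> matching_perms n"
  have "M (w (2 * i)) (w (2 * i + 1)) = M' (w (2 * i)) (w (2 * i + 1))" if "i < n" for i
  proof (rule assms)
    show "w (2 * i) < w (2 * i + 1)" using w that by (simp add: matching_perms_def)
    have "w permutes {..<2 * n}" using w by (simp add: matching_perms_def)
    moreover have "2 * i + 1 \<in> {..<2 * n}" using that by auto
    ultimately have "w (2 * i + 1) \<in> {..<2 * n}" by (simp only: permutes_in_image)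
    then show "w (2 * i + 1) < 2 * n" by simp
  qed
  then show "of_int (sign w) * (\<Prod>i<n. M (w (2 * i)) (w (2 * i + 1))) =
      of_int (sign w) * (\<Prod>i<n. M' (w (2 * i)) (w (2 * i + 1)))"
    by simp
qed

lemma matching_perms_0: "matching_perms 0 = {id}"
  by (auto simp: matching_perms_def)

lemma pfaffian_0 [simp]: "pfaffian 0 M = 1"
  by (simp add: pfaffian_matching_perms matching_perms_0 sign_id)

text \<open>
  The smallest vertex cannot be the larger end of an edge, nor the smaller end of a later edge.
\<close>

lemma matching_perms_first:
  assumes "w \<in> matching_perms (Suc n)"
  shows "w 0 = 0"
proof -
  have p: "w permutes {..<2 * Suc n}" and lt: "\<And>i. i < Suc n \<Longrightarrow> w (2 * i) < w (2 * i + 1)"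
    and mono: "\<And>i j. j < Suc n \<Longrightarrow> i < j \<Longrightarrow> w (2 * i) < w (2 * j)"
    using assms by (auto simp: matching_perms_def)
  have "0 \<in> w ` {..<2 * Suc n}" using permutes_image [OF p] by simp
  then obtain k where k: "k < 2 * Suc n" "w k = 0" by force
  show ?thesis
  proof (cases "even k")
    case True
    then obtain i where i: "k = 2 * i" by blast
    then show ?thesis using mono [of i 0] k by (cases "i = 0") auto
  next
    case False
    then obtain i where "k = 2 * i + 1" by (blast elim: oddE)
    then show ?thesis using lt [of i] k by auto
  qed
qed

text \<open>
  The matching that joins the vertex 0 to the vertex $j+1$ and is a given matching on the
  remaining vertices, renumbered in increasing order.
\<close>

definition add_first_edge :: "nat \<Rightarrow> (nat \<Rightarrow> nat) \<Rightarrow> nat \<Rightarrow> nat" where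
  "add_first_edge j w = permutation_insert 0 0 (permutation_insert 0 j w)"

lemma add_first_edge_apply [simp]:
  "add_first_edge j w 0 = 0"
  "add_first_edge j w (Suc 0) = Suc j"
  "add_first_edge j w (Suc (Suc i)) = Suc (insert_index j (w i))"
  by (simp_all add: add_first_edge_def permutation_insert_expand insert_index_def)

lemma insert_index_less_iff [simp]: "insert_index j a < insert_index j b \<longleftrightarrow> a < b"
  by (auto simp: insert_index_def)

lemma all_less_Suc_shift: "(\<forall>i<Suc n. P i) \<longleftrightarrow> P 0 \<and> (\<forall>i<n. P (Suc i))"
  by (auto simp: less_Suc_eq_0_disj)

lemma add_first_edge_permutes:
  assumes "w permutes {..<2 * n}" and "j \<le> 2 * n"
  shows "add_first_edge j w permutes {..<2 * Suc n}"
proof -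
  have "permutation_insert 0 j w permutes {0..<Suc (2 * n)}"
    using assms by (intro permutation_insert_permutes) (auto simp: lessThan_atLeast0)
  then have "add_first_edge j w permutes {0..<Suc (Suc (2 * n))}"
    unfolding add_first_edge_def by (rule permutation_insert_permutes) auto
  then show ?thesis by (simp add: lessThan_atLeast0)
qed

lemma sign_add_first_edge:
  assumes "w permutes {..<2 * n}" and "j \<le> 2 * n"
  shows "sign (add_first_edge j w) = (-1) ^ j * sign w"
proof -
  have w: "w permutes {0..<2 * n}" using assms by (simp add: lessThan_atLeast0)
  have "permutation_insert 0 j w permutes {0..<Suc (2 * n)}"
    using w assms(2) by (intro permutation_insert_permutes) auto
  then have "(signof (add_first_edge j w) :: int) = signof (permutation_insert 0 j w)"
    unfolding add_first_edge_def by (subst signof_permutation_insert) auto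
  also have "\<dots> = (-1) ^ j * signof w"
    using w assms(2) by (subst signof_permutation_insert) auto
  finally show ?thesis by simp
qed

lemma add_first_edge_matching:
  assumes "w permutes {..<2 * n}" and "j \<le> 2 * n"
  shows "add_first_edge j w \<in> matching_perms (Suc n) \<longleftrightarrow> w \<in> matching_perms n"
  using assms add_first_edge_permutes [OF assms]
  by (simp add: matching_perms_def all_less_Suc_shift)

lemma matching_perms_Suc:
  "matching_perms (Suc n) = (\<lambda>(j, w). add_first_edge j w) ` ({..<Suc (2 * n)} \<times> matching_perms n)"
proof (intro equalityI subsetI)
  fix w assume w: "w \<in> matching_perms (Suc n)"
  then have p: "w permutes {0..<Suc (Suc (2 * n))}"
    by (simp add: matching_perms_def lessThan_atLeast0)
  define v where "v = permutation_delete w 0"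
  have v: "v permutes {0..<Suc (2 * n)}"
    unfolding v_def using permutation_delete_permutes [OF p, of 0] by simp
  define u where "u = permutation_delete v 0"
  have u: "u permutes {..<2 * n}"
    unfolding u_def using permutation_delete_permutes [OF v, of 0] by (simp add: lessThan_atLeast0)
  have j: "v 0 \<le> 2 * n"
    using permutes_in_image [OF v, of 0] by simp
  have wv: "permutation_insert 0 0 v = w"
    using permutation_insert_delete [OF p, of 0] matching_perms_first [OF w] by (simp add: v_def)
  have "permutation_insert 0 (v 0) u = v"
    using permutation_insert_delete [OF v, of 0] by (simp add: u_def)
  then have eq: "w = add_first_edge (v 0) u"
    by (simp add: add_first_edge_def wv)
  then have "u \<in> matching_perms n"
    using w add_first_edge_matching [OF u j] by simp
  then show "w \<in> (\<lambda>(j, w). add_first_edge j w) ` ({..<Suc (2 * n)} \<times> matching_perms n)"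
    using eq j by (intro image_eqI [of _ _ "(v 0, u)"]) auto
next
  fix w assume "w \<in> (\<lambda>(j, w). add_first_edge j w) ` ({..<Suc (2 * n)} \<times> matching_perms n)"
  then obtain j u where "w = add_first_edge j u" "j \<le> 2 * n" "u \<in> matching_perms n"
    by auto
  moreover from this have "u permutes {..<2 * n}" by (simp add: matching_perms_def)
  ultimately show "w \<in> matching_perms (Suc n)"
    using add_first_edge_matching by blast
qed

lemma add_first_edge_inj:
  assumes "add_first_edge j w = add_first_edge j' w'"
  shows "j = j' \<and> w = w'"
proof -
  have j: "j = j'" using fun_cong [OF assms, of "Suc 0"] by simp
  have "w i = w' i" for i
    using fun_cong [OF assms, of "Suc (Suc i)"] j
    by (simp add: insert_index_def split: if_splits)
  with j show ?thesis by auto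
qed

text \<open>
  Expansion along the first row: a matching is determined by the partner $j+1$ of the vertex 0 and
  the matching of the other vertices.
\<close>

lemma pfaffian_Suc:
  "pfaffian (Suc n) M =
     (\<Sum>j<Suc (2 * n). (-1) ^ j * M 0 (Suc j) *
        pfaffian n (\<lambda>p q. M (Suc (insert_index j p)) (Suc (insert_index j q))))"
proof -
  let ?t = "\<lambda>w. of_int (sign w) * (\<Prod>i<Suc n. M (w (2 * i)) (w (2 * i + 1)))"
  have "pfaffian (Suc n) M =
      (\<Sum>(j, w)\<in>{..<Suc (2 * n)} \<times> matching_perms n. ?t (add_first_edge j w))"
    unfolding pfaffian_matching_perms matching_perms_Suc
    by (subst sum.reindex)
      (auto simp: inj_on_def case_prod_beta dest!: add_first_edge_inj)
  also have "\<dots> = (\<Sum>j<Suc (2 * n). \<Sum>w\<in>matching_perms n. ?t (add_first_edge j w))"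
    by (rule sum.cartesian_product [symmetric])
  also have "\<dots> = (\<Sum>j<Suc (2 * n). (-1) ^ j * M 0 (Suc j) *
        pfaffian n (\<lambda>p q. M (Suc (insert_index j p)) (Suc (insert_index j q))))"
    unfolding pfaffian_matching_perms sum_distrib_left
  proof (intro sum.cong refl)
    fix j w assume "j \<in> {..<Suc (2 * n)}" "w \<in> matching_perms n"
    then have "sign (add_first_edge j w) = (-1) ^ j * sign w"
      by (intro sign_add_first_edge) (auto simp: matching_perms_def)
    then show "?t (add_first_edge j w) = (-1) ^ j * M 0 (Suc j) *
        (of_int (sign w) * (\<Prod>i<n. M (Suc (insert_index j (w (2 * i))))
          (Suc (insert_index j (w (2 * i + 1))))))"
      by (simp add: prod.lessThan_Suc_shift algebra_simps del: prod.lessThan_Suc)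
  qed
  finally show ?thesis .
qed

text \<open>
  The Pfaffian of a kernel evaluated at a list, as a form on lists. It is extended by zero to the
  odd degrees, so that it is a single form of even parity.
\<close>

definition pf :: "('a \<Rightarrow> 'a \<Rightarrow> 'r::comm_ring_1) \<Rightarrow> 'a list \<Rightarrow> 'r" where
  "pf K L = (if even (length L) then pfaffian (length L div 2) (\<lambda>p q. K (L ! p) (L ! q)) else 0)"

lemma pf_odd: "odd (length L) \<Longrightarrow> pf K L = 0"
  by (simp add: pf_def)

lemma pf_Nil [simp]: "pf K [] = 1"
  by (simp add: pf_def)

lemma nth_delete:
  assumes "j < length xs" and "p < length xs - 1"
  shows "(take j xs @ drop (Suc j) xs) ! p = xs ! insert_index j p"
  using assms by (simp add: nth_append insert_index_def)

text \<open>
  The contraction of the Pfaffian form with a vector $x$ is its exterior product with the row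
  $K(x,\cdot)$. This is the characterisation of the Pfaffian that all later proofs use.
\<close>

lemma pf_Cons: "pf K (x # xs) = wedge1 (K x) (pf K) xs"
proof (cases "odd (length xs)")
  case True
  then obtain n where n: "length xs = Suc (2 * n)" by (metis oddE Suc_eq_plus1)
  have "pf K (x # xs) = (\<Sum>j<Suc (2 * n). (-1) ^ j * K x (xs ! j) *
      pfaffian n (\<lambda>p q. K (xs ! insert_index j p) (xs ! insert_index j q)))"
    using n by (simp add: pf_def pfaffian_Suc)
  also have "\<dots> = wedge1 (K x) (pf K) xs"
    unfolding wedge1_sum n
  proof (rule sum.cong [OF refl])
    fix j assume j: "j \<in> {..<Suc (2 * n)}"
    then have "length (take j xs @ drop (Suc j) xs) = 2 * n"
      using n by auto
    then have "pf K (take j xs @ drop (Suc j) xs) = pfaffian n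
        (\<lambda>p q. K ((take j xs @ drop (Suc j) xs) ! p) ((take j xs @ drop (Suc j) xs) ! q))"
      by (simp add: pf_def)
    also have "\<dots> = pfaffian n (\<lambda>p q. K (xs ! insert_index j p) (xs ! insert_index j q))"
      using j n by (intro pfaffian_cong) (simp add: nth_delete)
    finally show "(-1) ^ j * K x (xs ! j) *
        pfaffian n (\<lambda>p q. K (xs ! insert_index j p) (xs ! insert_index j q)) =
        (-1) ^ j * K x (xs ! j) * pf K (take j xs @ drop (Suc j) xs)"
      by simp
  qed
  finally show ?thesis .
next
  case False
  have "wedge1 (K x) (pf K) xs = wedge1 (K x) (\<lambda>_. 0) xs"
    using False by (intro wedge1_cong pf_odd) (metis even_Suc)
  then show ?thesis using False by (simp add: pf_odd)
qed

text \<open>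
  The equation determines a form from its values on shorter lists.
\<close>

lemma pf_unique:
  assumes "G [] = 1" and "\<And>x xs. G (x # xs) = wedge1 (K x) G xs"
  shows "G L = pf K L"
proof (induction L rule: length_induct)
  case (1 L)
  show ?case
  proof (cases L)
    case (Cons x xs)
    then show ?thesis
      using 1 by (simp add: assms(2) pf_Cons) (rule wedge1_cong, simp)
  qed (simp add: assms(1))
qed

section \<open>Alternation of the Pfaffian\<close>

text \<open>
  Alternation is stated for one length at a time, because it is propagated from shorter to longer
  lists.
\<close>

definition alternating_on_length :: "nat \<Rightarrow> ('a list \<Rightarrow> 'r::comm_ring_1) \<Rightarrow> bool" where
  "alternating_on_length n f \<longleftrightarrow>
     (\<forall>xs x y ys. length xs + length ys + 2 = n \<longrightarrow> f (xs @ x # y # ys) = - f (xs @ y # x # ys))"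

lemma wedge1_alternating:
  fixes f :: "'a list \<Rightarrow> 'r::comm_ring_1"
  assumes "alternating_on_length n f"
  shows "alternating_on_length (Suc n) (wedge1 u f)"
proof -
  have "wedge1 u f (xs @ x # y # ys) = - wedge1 u f (xs @ y # x # ys)"
    if "alternating_on_length n f" "length xs + length ys + 2 = Suc n" for xs ys :: "'a list"
        and x y n and f :: "'a list \<Rightarrow> 'r"
    using that
  proof (induction xs arbitrary: n f)
    case Nil
    have "f (x # y # l) = - f (y # x # l)" if "Suc (length l) = length ys" for l
      using Nil(1) [unfolded alternating_on_length_def, rule_format, of "[]" l x y] Nil(2) that
      by simp
    then have "wedge1 u (\<lambda>l. f (x # y # l)) ys = wedge1 u (\<lambda>l. - f (y # x # l)) ys"
      by (rule wedge1_cong)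
    then show ?case by (simp add: wedge1_minus_form)
  next
    case (Cons z xs)
    have "f (xs @ x # y # ys) = - f (xs @ y # x # ys)"
      using Cons.prems(1) [unfolded alternating_on_length_def, rule_format, of xs ys x y]
        Cons.prems(2) by simp
    moreover have "wedge1 u (\<lambda>l. f (z # l)) (xs @ x # y # ys) =
        - wedge1 u (\<lambda>l. f (z # l)) (xs @ y # x # ys)"
    proof (rule Cons.IH)
      show "alternating_on_length (length xs + length ys + 1) (\<lambda>l. f (z # l))"
        unfolding alternating_on_length_def
      proof (intro allI impI)
        fix xs' ys' :: "'a list" and x y assume "length xs' + length ys' + 2 = length xs
            + length ys + 1"
        then have "length (z # xs') + length ys' + 2 = n" using Cons.prems(2) by simp
        then show "f (z # xs' @ x # y # ys') = - f (z # xs' @ y # x # ys')"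
          using Cons.prems(1) [unfolded alternating_on_length_def, rule_format, of "z # xs'" ys' x
              y]
          by simp
      qed
    qed simp
    ultimately show ?case by simp
  qed
  then show ?thesis
    using assms unfolding alternating_on_length_def by blast
qed

text \<open>
  The diagonal needs a condition of its own, since the ring may have zero divisors dividing 2.
\<close>

locale antisymmetric_kernel =
  fixes K :: "'a \<Rightarrow> 'a \<Rightarrow> 'r::comm_ring_1"
  assumes antisym: "K x y = - K y x"
    and diag: "K x x = 0"
begin

lemma pf_Cons_Cons: "pf K (x # y # ys) = K x y * pf K ys - wedge1 (K x) (wedge1 (K y) (pf K)) ys"
  by (simp add: pf_Cons)

text \<open>
  An exchange behind the first entry is covered by the expansion along the first row. For an
  exchange of the first two entries the expansion along both rows leaves an antisymmetric entry
  and a product with two covectors, which anticommute.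
\<close>

lemma pf_alternating_on_length: "alternating_on_length n (pf K)"
proof (induction n rule: less_induct)
  case (less n)
  show ?case
    unfolding alternating_on_length_def
  proof (intro allI impI)
    fix xs ys :: "'a list" and x y assume len: "length xs + length ys + 2 = n"
    show "pf K (xs @ x # y # ys) = - pf K (xs @ y # x # ys)"
    proof (cases xs)
      case Nil
      then show ?thesis
        using antisym [of x y] wedge1_anticommute [of "K x" "K y" "pf K" ys]
        by (simp add: pf_Cons_Cons)
    next
      case (Cons z zs)
      have "alternating_on_length (length zs + length ys + 1) (pf K)"
        using less len Cons by simp
      from wedge1_alternating [OF this, of "K z", unfolded alternating_on_length_def, rule_format,
          of zs ys x y]
      show ?thesis by (simp add: Cons pf_Cons)
    qed
  qed
qed

lemma pf_swap_adjacent: "pf K (xs @ x # y # ys) = - pf K (xs @ y # x # ys)"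
  using pf_alternating_on_length [unfolded alternating_on_length_def, rule_format] by blast

lemma pf_move_front: "pf K (xs @ x # ys) = (-1) ^ length xs * pf K (x # xs @ ys)"
proof (induction xs arbitrary: ys rule: rev_induct)
  case (snoc z xs)
  have "pf K ((xs @ [z]) @ x # ys) = - pf K (xs @ x # z # ys)"
    using pf_swap_adjacent [of xs z x ys] by simp
  also have "pf K (xs @ x # z # ys) = (-1) ^ length xs * pf K (x # (xs @ [z]) @ ys)"
    using snoc [of "z # ys"] by simp
  finally show ?case by simp
qed simp

text \<open>
  A transposition of distant entries is a product of an odd number of adjacent ones.
\<close>

lemma pf_swap: "pf K (xs @ x # ys @ y # zs) = - pf K (xs @ y # ys @ x # zs)"
proof (induction ys arbitrary: xs)
  case Nil
  then show ?case using pf_swap_adjacent [of xs x y zs] by simp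
next
  case (Cons c ys)
  have "pf K (xs @ x # (c # ys) @ y # zs) = - pf K ((xs @ [c]) @ x # ys @ y # zs)"
    using pf_swap_adjacent [of xs x c "ys @ y # zs"] by simp
  also have "\<dots> = pf K ((xs @ [c]) @ y # ys @ x # zs)"
    by (simp only: Cons) simp
  also have "\<dots> = - pf K (xs @ y # (c # ys) @ x # zs)"
    using pf_swap_adjacent [of xs c y "ys @ x # zs"] by simp
  finally show ?case .
qed

lemma pf_front_repeated: "pf K (x # x # ys) = 0"
  by (simp add: pf_Cons_Cons diag wedge1_self)

lemma pf_not_distinct:
  assumes "\<not> distinct L"
  shows "pf K L = 0"
proof -
  obtain xs ys zs x where L: "L = xs @ x # ys @ x # zs"
    using not_distinct_decomp [OF assms] by auto
  have "pf K (x # (xs @ ys) @ x # zs) = (-1) ^ length (x # xs @ ys) * pf K (x # x # (xs @ ys) @ zs)"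
    using pf_move_front [of "x # xs @ ys" x zs] by simp
  then show ?thesis
    by (simp add: L pf_move_front [of xs] pf_front_repeated)
qed

lemma pf_swap_nth:
  assumes "a < length L" and "b < length L" and "a \<noteq> b"
  shows "pf K (L[a := L ! b, b := L ! a]) = - pf K L"
proof -
  have *: "pf K (L[a := L ! b, b := L ! a]) = - pf K L" if "a < b" "b < length L" for a b
  proof -
    define xs ys zs where "xs = take a L" and "ys = take (b - Suc a) (drop (Suc a) L)"
      and "zs = drop (Suc b) L"
    have "drop (Suc a) L = ys @ L ! b # zs"
      using that id_take_nth_drop [of "b - Suc a" "drop (Suc a) L"]
      by (simp add: ys_def zs_def)
    moreover define x y where "x = L ! a" and "y = L ! b"
    ultimately have L: "L = xs @ x # ys @ y # zs"
      using that id_take_nth_drop [of a L] by (simp add: xs_def)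
    have len: "length xs = a" "length ys = b - Suc a"
      using that by (auto simp: xs_def ys_def)
    have "b - a = Suc (b - Suc a)" using that by simp
    then have "(xs @ x # ys @ y # zs)[a := y, b := x] = xs @ y # ys @ x # zs"
      using that len by (simp add: list_update_append)
    then have "pf K ((xs @ x # ys @ y # zs)[a := y, b := x]) = - pf K (xs @ x # ys @ y # zs)"
      by (simp only: pf_swap [of xs y ys x zs])
    then have "pf K (L[a := y, b := x]) = - pf K L"
      by (simp only: L [symmetric])
    then show ?thesis by (simp only: x_def y_def)
  qed
  show ?thesis
  proof (cases "a < b")
    case True
    then show ?thesis using assms(2) by (rule *)
  next
    case False
    then have "pf K (L[b := L ! a, a := L ! b]) = - pf K L"
      using assms by (intro *) simp_all
    then show ?thesis
      by (subst list_update_swap [OF assms(3)])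
  qed
qed

lemma pf_permute:
  assumes "w permutes {..<length L}"
  shows "pf K (map (\<lambda>i. L ! w i) [0..<length L]) = of_int (sign w) * pf K L"
  using finite_lessThan assms
proof (induction rule: permutes_rev_induct)
  case id
  then show ?case by (simp add: map_nth sign_id)
next
  case (swap a b p)
  let ?P = "map (\<lambda>i. L ! p i) [0..<length L]"
  have "map (\<lambda>i. L ! (p \<circ> transpose a b) i) [0..<length L] = ?P[a := ?P ! b, b := ?P ! a]"
    using swap.hyps by (intro nth_equalityI) (auto simp: nth_list_update transpose_def)
  moreover have "sign (p \<circ> transpose a b) = - sign p"
    using swap.hyps permutation_permutes [of p]
    by (subst sign_compose) (auto simp: sign_swap_id permutation_swap_id)
  ultimately show ?case
    using swap pf_swap_nth [of a ?P b] by (simp del: o_apply map_update)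
qed

end

section \<open>Pfaffians of modified kernels\<close>

lemma pf_map: "pf K (map g L) = pf (\<lambda>x y. K (g x) (g y)) L"
  unfolding pf_def by (auto intro!: pfaffian_cong)

lemma pf_minus:
  fixes K :: "'a \<Rightarrow> 'a \<Rightarrow> 'r::comm_ring_1"
  shows "pf (\<lambda>x y. - K x y) L = (-1) ^ (length L div 2) * pf K L"
proof -
  have "pfaffian n (\<lambda>x y. - M x y) = (-1) ^ n * pfaffian n M" for n and M :: "nat \<Rightarrow> nat \<Rightarrow> 'r"
    unfolding pfaffian_def sum_distrib_left by (rule sum.cong) (simp_all add: prod_uminus mult_ac)
  then show ?thesis by (simp add: pf_def)
qed

text \<open>
  The right-hand side solves the equation of the Pfaffian on the left: all terms in which $u$ or
  $v$ occurs twice vanish, and covectors anticommute.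
\<close>

lemma pf_rank_two_update:
  "pf (\<lambda>x y. K x y + (u x * v y - v x * u y)) L = pf K L + wedge1 u (wedge1 v (pf K)) L"
proof -
  let ?G = "\<lambda>L. pf K L + wedge1 u (wedge1 v (pf K)) L"
  have "?G (x # xs) = wedge1 (\<lambda>y. K x y + (u x * v y - v x * u y)) ?G xs" for x xs
  proof -
    have uu: "wedge1 u (wedge1 u (wedge1 v (pf K))) xs = 0" by (rule wedge1_self)
    have vv: "wedge1 v (wedge1 u (wedge1 v (pf K))) xs = 0"
      by (subst wedge1_anticommute) (simp add: wedge1_self [abs_def])
    have ka: "wedge1 v (wedge1 (K x) (pf K)) = (\<lambda>l. - wedge1 (K x) (wedge1 v (pf K)) l)"
      using wedge1_anticommute by blast
    have kk: "wedge1 u (wedge1 v (wedge1 (K x) (pf K))) xs =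
        wedge1 (K x) (wedge1 u (wedge1 v (pf K))) xs"
      unfolding ka wedge1_minus_form using wedge1_anticommute [of u "K x"] by simp
    have "wedge1 (\<lambda>y. K x y + (u x * v y - v x * u y)) f xs =
        wedge1 (K x) f xs + (u x * wedge1 v f xs - v x * wedge1 u f xs)" for f
      using wedge1_add [of "K x" "\<lambda>y. u x * v y + - v x * u y" f xs]
        wedge1_add [of "\<lambda>y. u x * v y" "\<lambda>y. - v x * u y" f xs]
      by (simp add: wedge1_scale)
         (simp add: wedge1_minus wedge1_scale)
    then show ?thesis
      using uu vv kk
      by (simp only: pf_Cons wedge1_add_form wedge1.simps wedge1_diff_form wedge1_scale_form)
        (simp add: algebra_simps)
  qed
  then show ?thesis
    by (intro pf_unique [symmetric]) auto
qed

text \<open>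
  The expansion of the Pfaffian of a sum over complementary subsets of the rows. Both sides solve
  the same equation because contraction is a derivation of the exterior product.
\<close>

lemma pf_add: "pf (\<lambda>x y. K x y + M x y) L = wedge (pf K) (pf M) L"
proof (rule pf_unique [symmetric])
  fix x xs
  have "grade_sign (pf K) = pf K"
    by (auto simp: grade_sign_def pf_def)
  then show "wedge (pf K) (pf M) (x # xs) = wedge1 (\<lambda>y. K x y + M x y) (wedge (pf K) (pf M)) xs"
    by (simp add: wedge1_add pf_Cons wedge1_wedge_left)
       (simp add: wedge1_wedge_right flip: wedge1_wedge_left)
qed simp

text \<open>
  The number of entries with the property $P$ minus the number of entries without it.
\<close>

definition balance :: "('a \<Rightarrow> bool) \<Rightarrow> 'a list \<Rightarrow> int" where
  "balance P L = (\<Sum>x\<leftarrow>L. if P x then 1 else - 1)"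

lemma balance_simps [simp]:
  "balance P [] = 0"
  "balance P (x # xs) = (if P x then 1 else - 1) + balance P xs"
  by (simp_all add: balance_def)

lemma balance_append: "balance P (xs @ ys) = balance P xs + balance P ys"
  by (simp add: balance_def)

lemma balance_delete:
  assumes "j < length xs"
  shows "balance P (take j xs @ drop (Suc j) xs) = balance P xs - (if P (xs ! j) then 1 else - 1)"
proof -
  have "balance P xs = balance P (take j xs @ xs ! j # drop (Suc j) xs)"
    using id_take_nth_drop [OF assms] by simp
  then show ?thesis by (simp add: balance_append)
qed

lemma pf_Cons_sum:
  "pf K (x # xs) = (\<Sum>j<length xs. (-1) ^ j * K x (xs ! j) * pf K (take j xs @ drop (Suc j) xs))"
  by (simp add: pf_Cons wedge1_sum)

text \<open>
  If more than half of the entries have the property $P$, every perfect matching joins two of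
  them.
\<close>

lemma pf_isotropic_eq_0:
  assumes isotropic: "\<And>x y. P x \<Longrightarrow> P y \<Longrightarrow> K x y = 0"
  shows "0 < balance P L \<Longrightarrow> pf K L = 0"
proof (induction L rule: length_induct)
  case (1 L)
  then obtain x xs where L: "L = x # xs" by (cases L) auto
  have "K x (xs ! j) * pf K (take j xs @ drop (Suc j) xs) = 0" if j: "j < length xs" for j
  proof (cases "P x \<and> P (xs ! j)")
    case False
    then have "0 < balance P (take j xs @ drop (Suc j) xs)"
      using 1(2) j by (auto simp: L balance_delete split: if_splits)
    then show ?thesis using 1(1) j by (simp add: L)
  qed (simp add: isotropic)
  then show ?case by (simp add: L pf_Cons_sum mult.assoc)
qed

text \<open>
  If exactly half of the entries have the property $P$, a perfect matching that joins none of them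
  to each other cannot join two entries without it either. Hence the kernel matters only on pairs
  with an entry in $P$.
\<close>

lemma pf_isotropic_cong:
  assumes isotropic: "\<And>x y. P x \<Longrightarrow> P y \<Longrightarrow> K x y = 0"
    and eq: "\<And>x y. P x \<or> P y \<Longrightarrow> K x y = K' x y"
  shows "balance P L = 0 \<Longrightarrow> pf K L = pf K' L"
proof (induction L rule: length_induct)
  case (1 L)
  show ?case
  proof (cases L)
    case (Cons x xs)
    have "K x (xs ! j) * pf K (take j xs @ drop (Suc j) xs) =
        K' x (xs ! j) * pf K' (take j xs @ drop (Suc j) xs)" if j: "j < length xs" for j
    proof -
      let ?ys = "take j xs @ drop (Suc j) xs"
      consider "P x" "P (xs ! j)" | "P x \<longleftrightarrow> \<not> P (xs ! j)" | "\<not> P x" "\<not> P (xs ! j)" by blast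
      then show ?thesis
      proof cases
        case 1
        then show ?thesis using isotropic [of x "xs ! j"] eq [of x "xs ! j"] by simp
      next
        case 2
        then have "balance P ?ys = 0"
          using \<open>balance P L = 0\<close> j by (auto simp: Cons balance_delete split: if_splits)
        then have "pf K ?ys = pf K' ?ys" using "1.IH" j by (simp add: Cons)
        then show ?thesis using eq [of x "xs ! j"] 2 by auto
      next
        case 3
        then have "0 < balance P ?ys"
          using \<open>balance P L = 0\<close> j by (auto simp: Cons balance_delete)
        moreover have "\<And>x y. P x \<Longrightarrow> P y \<Longrightarrow> K' x y = 0" using isotropic eq by metis
        ultimately show ?thesis
          using pf_isotropic_eq_0 [of P K ?ys] pf_isotropic_eq_0 [of P K' ?ys] isotropic by simp
      qed
    qed
    then show ?thesis by (simp add: Cons pf_Cons_sum mult.assoc)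
  qed simp
qed

lemma wedge1_pf_even: "even (length l) \<Longrightarrow> wedge1 u (pf K) l = 0"
proof -
  assume "even (length l)"
  then have "wedge1 u (pf K) l = wedge1 u (\<lambda>_. 0) l"
    by (intro wedge1_cong pf_odd) (metis even_Suc)
  then show ?thesis by simp
qed

section \<open>Sums of products of two Pfaffians over interleaved lists\<close>

lemma wedge1_map: "wedge1 u f (map g xs) = wedge1 (\<lambda>x. u (g x)) (\<lambda>l. f (map g l)) xs"
  by (induction xs arbitrary: f) simp_all

text \<open>
  The restriction of a form to the vectors in $P$, with the sign that a Pfaffian of this degree
  acquires when its kernel is replaced by the negative.
\<close>

definition restrict_form :: "('a \<Rightarrow> bool) \<Rightarrow> ('a list \<Rightarrow> 'r::comm_ring_1) \<Rightarrow> 'a list \<Rightarrow> 'r" where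
  "restrict_form P f l = (if \<forall>x\<in>set l. P x then (-1) ^ (length l div 2) * f l else 0)"

lemma wedge1_restrict:
  "wedge1 (\<lambda>x. if P x then u x else 0) (\<lambda>l. if \<forall>x\<in>set l. P x then f l else 0) xs =
     (if \<forall>x\<in>set xs. P x then wedge1 u f xs else 0)"
proof (induction xs arbitrary: f)
  case (Cons x xs)
  then show ?case by (cases "P x") (auto simp: wedge1_minus)
qed simp

lemma wedge1_restrict_form:
  "wedge1 (\<lambda>x. if P x then u x else 0) (restrict_form P f) xs =
     (if \<forall>x\<in>set xs. P x then (-1) ^ ((length xs - 1) div 2) * wedge1 u f xs else 0)"
  unfolding restrict_form_def wedge1_restrict
  by (simp add: wedge1_graded [where s = "\<lambda>n. (-1) ^ (n div 2)"])

lemma restrict_form_pf: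
  "restrict_form P (pf K) L = pf (\<lambda>x y. if P x \<and> P y then - K x y else 0) L"
proof (rule pf_unique)
  fix x xs
  let ?N = "\<lambda>x y. if P x \<and> P y then - K x y else 0"
  show "restrict_form P (pf K) (x # xs) = wedge1 (?N x) (restrict_form P (pf K)) xs"
  proof (cases "P x \<and> odd (length xs)")
    case True
    then have "wedge1 (?N x) (restrict_form P (pf K)) xs =
        (if \<forall>x\<in>set xs. P x then (-1) ^ ((length xs - 1) div 2) * - pf K (x # xs) else 0)"
      using wedge1_restrict_form [of P "\<lambda>y. - K x y" "pf K" xs]
      by (simp add: wedge1_minus pf_Cons)
    moreover have "Suc (length xs) div 2 = Suc ((length xs - 1) div 2)"
      using True by (auto elim!: oddE)
    ultimately show ?thesis using True by (simp add: restrict_form_def)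
  next
    case False
    have "wedge1 (?N x) (restrict_form P (pf K)) xs = 0"
    proof (cases "P x")
      case True
      then show ?thesis
        using wedge1_restrict_form [of P "\<lambda>y. - K x y" "pf K" xs] False
        by (simp add: wedge1_minus wedge1_pf_even)
    qed (simp add: wedge1_eq_0)
    then show ?thesis using False by (auto simp: restrict_form_def pf_odd)
  qed
qed (simp add: restrict_form_def)

text \<open>
  In the odd degrees, where this form is supported, the Pfaffian inside the product has degree one
  less, and both degrees give the same sign.
\<close>

lemma restrict_form_wedge1_pf:
  "restrict_form P (wedge1 v (pf K)) L =
     wedge1 (\<lambda>x. if P x then v x else 0) (restrict_form P (pf K)) L"
proof (cases "even (length L)")
  case True
  then show ?thesis by (simp add: wedge1_restrict_form restrict_form_def wedge1_pf_even)
next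
  case False
  then have "(length L - 1) div 2 = length L div 2" by (auto elim!: oddE)
  then show ?thesis by (simp add: wedge1_restrict_form restrict_form_def)
qed

text \<open>
  In even degree this is the Pfaffian, and in odd degree the Pfaffian of the kernel bordered by
  the row and column $v$, expanded along the border.
\<close>

definition bordered_pf :: "('a \<Rightarrow> 'a \<Rightarrow> 'r::comm_ring_1) \<Rightarrow> ('a \<Rightarrow> 'r) \<Rightarrow> 'a list \<Rightarrow> 'r" where
  "bordered_pf K v L = pf K L + wedge1 v (pf K) L"

text \<open>
  In even degree only two of the four products of the homogeneous parts survive. The product of
  the even parts is the Pfaffian of a sum of kernels, in which the block $P\times P$ cancels, and
  the product of the odd parts is its rank two correction.
\<close>

lemma wedge_restricted_bordered_pf:
  fixes K :: "'a \<Rightarrow> 'a \<Rightarrow> 'r::comm_ring_1"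
  assumes "even (length L)"
  shows "wedge (restrict_form P (bordered_pf K v)) (bordered_pf K v) L =
    pf (\<lambda>x y. (if P x \<and> P y then 0 else K x y) +
       ((if P x then v x else 0) * v y - v x * (if P y then v y else 0))) L"
proof -
  let ?u = "\<lambda>x. if P x then v x else 0"
  define f0 where "f0 = pf (\<lambda>x y. if P x \<and> P y then - K x y else 0)"
  define q0 where "q0 = pf K"
  let ?H = "\<lambda>x y. if P x \<and> P y then 0 else K x y"
  have f: "restrict_form P (bordered_pf K v) = (\<lambda>l. f0 l + wedge1 ?u f0 l)"
  proof
    fix l
    have "restrict_form P (bordered_pf K v) l =
        restrict_form P (pf K) l + restrict_form P (wedge1 v (pf K)) l"
      by (simp add: restrict_form_def bordered_pf_def algebra_simps)
    then show "restrict_form P (bordered_pf K v) l = f0 l + wedge1 ?u f0 l"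
      by (simp only: restrict_form_wedge1_pf)
        (simp only: restrict_form_pf [abs_def] f0_def)
  qed
  have q: "bordered_pf K v = (\<lambda>l. q0 l + wedge1 v q0 l)"
    by (simp add: bordered_pf_def q0_def fun_eq_iff)
  have f0q0: "wedge f0 q0 = pf ?H"
  proof
    fix l
    have "?H = (\<lambda>x y. (if P x \<and> P y then - K x y else 0) + K x y)"
      by (simp add: fun_eq_iff)
    then show "wedge f0 q0 l = pf ?H l" by (simp only: f0_def q0_def pf_add)
  qed
  have odd0: "wedge1 v q0 l = 0" "wedge1 ?u f0 l = 0" if "even (length l)" for l
    using that by (simp_all add: q0_def f0_def wedge1_pf_even)
  have ev0: "q0 l = 0" "f0 l = 0" if "odd (length l)" for l
    using that by (simp_all add: q0_def f0_def pf_odd)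
  have c1: "wedge f0 (wedge1 v q0) L = 0"
    by (rule wedge_eq_0) (metis assms even_add odd0(1) ev0(2))
  have c2: "wedge (wedge1 ?u f0) q0 L = 0"
    by (rule wedge_eq_0) (metis assms even_add odd0(2) ev0(1))
  have gs: "grade_sign f0 = f0"
  proof
    fix l
    show "grade_sign f0 l = f0 l"
      using ev0(2) [of l] by (cases "even (length l)") (simp_all add: grade_sign_def)
  qed
  have "wedge f0 (wedge1 v q0) = wedge1 v (wedge f0 q0)"
    by (simp add: fun_eq_iff wedge1_wedge_right gs)
  then have c3: "wedge (wedge1 ?u f0) (wedge1 v q0) L = wedge1 ?u (wedge1 v (pf ?H)) L"
    by (simp only: wedge1_wedge_left [symmetric] f0q0)
  have "wedge (restrict_form P (bordered_pf K v)) (bordered_pf K v) L =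
      pf ?H L + wedge1 ?u (wedge1 v (pf ?H)) L"
    unfolding f unfolding q unfolding wedge_add_left wedge_add_right c1 c2 c3 f0q0 by simp
  then show ?thesis
    by (simp only: pf_rank_two_update)
qed

lemma sum_Pow_lessThan_Suc:
  "(\<Sum>I\<in>Pow {..<Suc n}. F I) = (\<Sum>I\<in>Pow {..<n}. F (Suc ` I) + F (insert 0 (Suc ` I)))"
proof -
  have inj: "inj_on ((`) Suc) (Pow {..<n})"
    by (auto simp: inj_on_def inj_image_eq_iff)
  have inj': "inj_on (insert 0) (Pow (Suc ` {..<n}))"
    by (rule inj_on_inverseI [where g = "\<lambda>S. S - {0}"]) auto
  have "(\<Sum>I\<in>Pow {..<Suc n}. F I) =
      (\<Sum>J\<in>Pow (Suc ` {..<n}). F J) + (\<Sum>J\<in>insert 0 ` Pow (Suc ` {..<n}). F J)"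
    unfolding lessThan_Suc_eq_insert_0 Pow_insert by (rule sum.union_disjoint) auto
  also have "\<dots> = (\<Sum>J\<in>Pow (Suc ` {..<n}). F J) + (\<Sum>J\<in>Pow (Suc ` {..<n}). F (insert 0 J))"
    by (simp add: sum.reindex [OF inj'])
  also have "Pow (Suc ` {..<n}) = (`) Suc ` Pow {..<n}"
    by (rule image_Pow_surj [symmetric]) simp
  finally show ?thesis
    by (simp add: sum.reindex [OF inj] sum.distrib)
qed

text \<open>
  The entries are marked by the list they come from, so that equal numbers in both lists stay
  distinguishable.
\<close>

definition marked_splice :: "'a list \<Rightarrow> 'a list \<Rightarrow> (bool \<times> 'a) list" where
  "marked_splice X Y = splice (map (Pair True) X) (map (Pair False) Y)"

lemma marked_splice_simps [simp]:
  "marked_splice [] [] = []"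
  "marked_splice (x # X) (y # Y) = (True, x) # (False, y) # marked_splice X Y"
  by (simp_all add: marked_splice_def)

text \<open>
  The sign in \<^const>\<open>restrict_form\<close> cancels the one for moving a vector past the
  arguments of the first factor. This is why the sum over subsets of an interleaved list carries
  no signs.
\<close>

lemma restrict_form_Cons:
  "(\<lambda>l. grade_sign (\<lambda>l. restrict_form P f (x # l)) l) =
    (if P x then restrict_form P (\<lambda>l. f (x # l)) else (\<lambda>_. 0))"
proof -
  have "(-1) ^ n * (-1) ^ (Suc n div 2) = ((-1) ^ (n div 2) :: 'b)" for n
    by (cases "even n") (auto elim!: evenE oddE simp flip: power_add)
  then show ?thesis
    by (auto simp: grade_sign_def restrict_form_def fun_eq_iff simp flip: mult.assoc)
qed

lemma wedge_0_left: "wedge (\<lambda>_. 0) g xs = 0"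
  by (rule wedge_eq_0) simp

text \<open>
  Each pair $x,y$ of the interleaved list adds no sign if $x$ stays, since then both entries pass
  the arguments of the first factor. If $x$ is taken out, only $y$ passes them, and the resulting
  sign is the one that \<open>restrict_form_Cons\<close> absorbs.
\<close>

lemma sum_interleave_minus:
  assumes "length X = length Y"
  shows "(\<Sum>I\<in>Pow {..<length X}. h (nths X I) * g (interleave_minus X Y I)) =
    wedge (restrict_form fst (\<lambda>l. h (map snd l))) (\<lambda>l. g (map snd l)) (marked_splice X Y)"
  using assms
proof (induction X Y arbitrary: h g rule: list_induct2)
  case Nil
  then show ?case by (simp add: interleave_minus_def restrict_form_def)
next
  case (Cons x X y Y)
  have j: "{j. Suc j \<in> Suc ` I} = I" "{j. Suc j \<in> insert 0 (Suc ` I)} = I" for I by auto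
  have im: "interleave_minus (x # X) (y # Y) I =
      (if 0 \<in> I then [] else [x]) @ y # interleave_minus X Y {j. Suc j \<in> I}" for I
  proof -
    have "{j. Suc (Suc j) \<in> - ((*) 2 ` I)} = - ((*) 2 ` {j. Suc j \<in> I})"
    proof -
      have "Suc (Suc j) \<in> (*) 2 ` I \<longleftrightarrow> j \<in> (*) 2 ` {j. Suc j \<in> I}" for j
      proof
        assume "Suc (Suc j) \<in> (*) 2 ` I"
        then obtain i where "i \<in> I" "Suc (Suc j) = 2 * i" by auto
        then show "j \<in> (*) 2 ` {j. Suc j \<in> I}"
          by (intro image_eqI [of _ _ "i - 1"]) auto
      next
        assume "j \<in> (*) 2 ` {j. Suc j \<in> I}"
        then obtain i where "Suc i \<in> I" "j = 2 * i" by auto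
        then show "Suc (Suc j) \<in> (*) 2 ` I"
          by (intro image_eqI [of _ _ "Suc i"]) auto
      qed
      then show ?thesis by auto
    qed
    moreover have "Suc 0 \<notin> (*) 2 ` I" by (auto simp: Suc_double_not_eq_double)
    moreover have "0 \<in> (*) 2 ` I \<longleftrightarrow> 0 \<in> I" by auto
    ultimately show ?thesis
      unfolding interleave_minus_def by (simp add: nths_Cons)
  qed
  have "(\<Sum>I\<in>Pow {..<length (x # X)}. h (nths (x # X) I) * g (interleave_minus (x # X) (y # Y) I)) =
      (\<Sum>I\<in>Pow {..<length X}. h (nths X I) * g (x # y # interleave_minus X Y I)) +
      (\<Sum>I\<in>Pow {..<length X}. h (x # nths X I) * g (y # interleave_minus X Y I))"
    by (simp add: sum_Pow_lessThan_Suc im nths_Cons j sum.distrib)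
  also have "\<dots> = wedge (restrict_form fst (\<lambda>l. h (map snd l))) (\<lambda>l. g (x # y # map snd l))
      (marked_splice X Y)
      + wedge (restrict_form fst (\<lambda>l. h (x # map snd l))) (\<lambda>l. g (y # map snd l)) (marked_splice X
          Y)"
    using Cons.IH [of h "\<lambda>l. g (x # y # l)"] Cons.IH [of "\<lambda>l. h (x # l)" "\<lambda>l. g (y # l)"] by simp
  also have "\<dots> = wedge (restrict_form fst (\<lambda>l. h (map snd l))) (\<lambda>l. g (map snd l)) (marked_splice
      (x # X) (y # Y))"
  proof -
    let ?f = "restrict_form fst (\<lambda>l. h (map snd l))"
    have a: "(\<lambda>l. grade_sign ?f ((False, y) # l)) = (\<lambda>_. 0)"
      by (simp add: grade_sign_def restrict_form_def)
    have b: "(\<lambda>l. ?f ((True, x) # (False, y) # l)) = (\<lambda>_. 0)"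
      by (simp add: restrict_form_def)
    have c: "grade_sign (\<lambda>l. ?f ((True, x) # l)) = restrict_form fst (\<lambda>l. h (x # map snd l))"
      using restrict_form_Cons [of fst "\<lambda>l. h (map snd l)" "(True, x)"] by simp
    show ?thesis by (simp add: a b c wedge_0_left)
  qed
  finally show ?case .
qed

text \<open>
  The antisymmetric matrix with vanishing diagonal blocks and off-diagonal blocks $E$ and
  $-E^{T}$. Its Pfaffian on an interleaved list is the determinant of $E$.
\<close>

fun cross_kernel :: "('a \<Rightarrow> 'a \<Rightarrow> 'r::comm_ring_1) \<Rightarrow> bool \<times> 'a \<Rightarrow> bool \<times> 'a \<Rightarrow> 'r" where
  "cross_kernel E (True, a) (False, b) = E a b"
| "cross_kernel E (False, b) (True, a) = - E a b"
| "cross_kernel E _ _ = 0"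

lemma antisymmetric_cross_kernel: "antisymmetric_kernel (cross_kernel E)"
proof
  fix x y :: "bool \<times> 'a"
  show "cross_kernel E x y = - cross_kernel E y x" by (cases x; cases y; cases "fst x"; cases "fst
      y") auto
  show "cross_kernel E x x = 0" by (cases x; cases "fst x") auto
qed

lemma length_marked_splice: "length X = length Y \<Longrightarrow> length (marked_splice X Y) = 2 * length X"
  by (induction X Y rule: list_induct2) auto

lemma balance_marked_splice: "length X = length Y \<Longrightarrow> balance fst (marked_splice X Y) = 0"
  by (induction X Y rule: list_induct2) auto

text \<open>
  The kernel of the single Pfaffian still equals $M$ on the block of the entries from $Y$, but a
  list with as many entries from $X$ as from $Y$ does not see that block.
\<close>

lemma sum_bordered_pf_interleave_minus:
  fixes M :: "'a \<Rightarrow> 'a \<Rightarrow> 'r::comm_ring_1"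
  assumes "antisymmetric_kernel M" and len: "length X = length Y"
  shows "(\<Sum>I\<in>Pow {..<length X}. bordered_pf M v (nths X I)
      * bordered_pf M v (interleave_minus X Y I)) =
    pf (cross_kernel (\<lambda>a b. M a b + v a * v b)) (marked_splice X Y)"
proof -
  interpret antisymmetric_kernel M by fact
  let ?M = "\<lambda>x y. M (snd x) (snd y)" and ?v = "\<lambda>x. v (snd x)"
  let ?K = "\<lambda>x y. (if fst x \<and> fst y then 0 else ?M x y) +
       ((if fst x then ?v x else 0) * ?v y - ?v x * (if fst y then ?v y else 0))"
  have eq: "(\<lambda>l :: (bool \<times> 'a) list. bordered_pf M v (map snd l)) = bordered_pf ?M ?v"
    by (simp add: bordered_pf_def fun_eq_iff wedge1_map pf_map)
  have "(\<Sum>I\<in>Pow {..<length X}. bordered_pf M v (nths X I)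
      * bordered_pf M v (interleave_minus X Y I)) =
      pf ?K (marked_splice X Y)"
    unfolding sum_interleave_minus [OF len] eq
    by (rule wedge_restricted_bordered_pf) (simp add: length_marked_splice [OF len])
  also have "\<dots> = pf (cross_kernel (\<lambda>a b. M a b + v a * v b)) (marked_splice X Y)"
  proof (rule pf_isotropic_cong [of fst])
    fix x y :: "bool \<times> 'a"
    show "?K x y = 0" if "fst x" "fst y" using that by simp
    show "?K x y = cross_kernel (\<lambda>a b. M a b + v a * v b) x y" if "fst x \<or> fst y"
    proof -
      obtain s a t b where "x = (s, a)" "y = (t, b)" by (cases x; cases y)
      then show ?thesis
        using that antisym [of b a] by (cases s; cases t) (simp_all add: mult.commute)
    qed
  qed (rule balance_marked_splice [OF len])
  finally show ?thesis .
qed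

lemma pf_cross_kernel_map:
  assumes "length X = length Y"
  shows "pf (cross_kernel E) (marked_splice (map f X) (map g Y)) =
    pf (cross_kernel (\<lambda>a b. E (f a) (g b))) (marked_splice X Y)"
proof -
  let ?h = "\<lambda>(s, a). (s, if s then f a else g a)"
  have "marked_splice (map f X) (map g Y) = map ?h (marked_splice X Y)"
    using assms by (induction X Y rule: list_induct2) auto
  moreover have "cross_kernel E (?h x) (?h y) = cross_kernel (\<lambda>a b. E (f a) (g b)) x y" for x y
    by (cases x; cases y; cases "fst x"; cases "fst y") auto
  ultimately show ?thesis by (simp add: pf_map)
qed

text \<open>
  Invariance of a determinant under transposition: exchanging the entries of each of the $n$ pairs
  and reversing the sign of the kernel both give the factor $(-1)^n$.
\<close>

lemma pf_cross_kernel_transpose: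
  assumes "length X = length Y"
  shows "pf (cross_kernel E) (marked_splice X Y) =
    pf (cross_kernel (\<lambda>b a. E a b)) (marked_splice Y X)"
proof -
  interpret antisymmetric_kernel "cross_kernel E" by (rule antisymmetric_cross_kernel)
  let ?S = "splice (map (Pair False) Y) (map (Pair True) X)"
  let ?flip = "\<lambda>(s, a). (\<not> s, a)"
  have "pf (cross_kernel E) (zs @ splice (map (Pair False) Y) (map (Pair True) X)) =
      (-1) ^ length X * pf (cross_kernel E) (zs @ marked_splice X Y)" for zs
    using assms
  proof (induction X Y arbitrary: zs rule: list_induct2)
    case (Cons x X y Y)
    have "pf (cross_kernel E) (zs @ (False, y) # (True, x) # splice (map (Pair False) Y) (map
        (Pair True) X)) =
        - pf (cross_kernel E) ((zs @ [(True, x), (False, y)]) @ splice (map (Pair False) Y) (map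
            (Pair True) X))"
      using pf_swap_adjacent [of zs "(False, y)" "(True, x)"] by simp
    then show ?case by (simp only: Cons.IH) simp
  qed simp
  from this [of "[]"] have swap: "pf (cross_kernel E) ?S = (-1) ^ length X
      * pf (cross_kernel E) (marked_splice X Y)"
    by simp
  have "marked_splice Y X = map ?flip ?S"
    using assms by (induction X Y rule: list_induct2) auto
  moreover have "cross_kernel (\<lambda>b a. E a b) (?flip x) (?flip y) = - cross_kernel E x y" for x y
    by (cases x; cases y; cases "fst x"; cases "fst y") auto
  ultimately have "pf (cross_kernel (\<lambda>b a. E a b)) (marked_splice Y X) = (-1) ^ (length ?S div 2)
      * pf (cross_kernel E) ?S"
    by (simp add: pf_map pf_minus)
  also have "length ?S div 2 = length X"
    using assms by simp
  finally show ?thesis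
    by (simp add: swap mult.assoc [symmetric] power_add [symmetric])
qed

section \<open>Relations between the functions $Q_j$\<close>

text \<open>
  The substitution of $-t$ for $t$.
\<close>

definition alternate_signs :: "'a::comm_ring_1 fps \<Rightarrow> 'a fps" where
  "alternate_signs f = Abs_fps (\<lambda>n. (-1) ^ n * fps_nth f n)"

lemma alternate_signs_mult: "alternate_signs (f * g) = alternate_signs f * alternate_signs g"
proof (rule fps_ext)
  fix n
  have "(-1) ^ n * (fps_nth f i * fps_nth g (n - i)) =
      ((-1) ^ i * fps_nth f i) * ((-1) ^ (n - i) * fps_nth g (n - i))" if "i \<le> n" for i
  proof -
    have "(-1 :: 'a) ^ n = (-1) ^ i * (-1) ^ (n - i)" using that by (simp flip: power_add)
    then show ?thesis by simp
  qed
  then show "fps_nth (alternate_signs (f * g)) n = fps_nth (alternate_signs f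
      * alternate_signs g) n"
    by (simp add: alternate_signs_def fps_mult_nth sum_distrib_left)
qed

text \<open>
  In terms of fractions, $q=b/a$ and $q'=a/b$.
\<close>

lemma mult_eq_1_of_swapped:
  fixes a b :: "'a::comm_monoid_mult"
  assumes "a * q = b" and "b * q' = a" and "a * a' = 1" and "b * b' = 1"
  shows "q * q' = 1"
proof -
  have "q * q' = (a * a') * (b * b') * (q * q')" by (simp add: assms(3,4))
  also have "\<dots> = (a' * b') * ((a * q) * (b * q'))" by (simp only: mult_ac)
  also have "\<dots> = (a * a') * (b * b')" by (simp only: assms(1,2) mult_ac)
  finally show ?thesis by (simp add: assms(3,4))
qed

text \<open>
  The substitution of $-t$ for $t$ exchanges numerator and denominator of each factor.
\<close>

lemma Q_factor_alternate_signs: "Q_factor r * alternate_signs (Q_factor r) = 1"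
proof -
  let ?x = "fps_const (mps_var r :: int mps) * fps_X" and ?q = "Q_factor r"
  have neg: "alternate_signs (1 - ?x) = 1 + ?x" "alternate_signs (1 + ?x) = 1 - ?x"
    by (auto simp: alternate_signs_def fps_eq_iff fps_X_def)
  have 1: "(1 - ?x) * ?q = 1 + ?x" by (rule Q_factor_inverse)
  from arg_cong [OF this, of alternate_signs] have 2: "(1 + ?x) * alternate_signs ?q = 1 - ?x"
    by (simp only: alternate_signs_mult neg)
  have "(1 - ?x) * fps_right_inverse (1 - ?x) 1 = 1" "(1 + ?x) * fps_right_inverse (1 + ?x) 1 = 1"
    by (rule fps_right_inverse, simp)+
  with 1 2 show ?thesis by (rule mult_eq_1_of_swapped)
qed

lemma Q_partial_product_alternate_signs:
  "(\<Prod>r<N. Q_factor r) * alternate_signs (\<Prod>r<N. Q_factor r) = 1"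
proof (induction N)
  case 0
  then show ?case by (auto simp: alternate_signs_def fps_eq_iff)
next
  case (Suc N)
  let ?P = "\<Prod>r<N. Q_factor r"
  have "(\<Prod>r<Suc N. Q_factor r) * alternate_signs (\<Prod>r<Suc N. Q_factor r) =
      (?P * alternate_signs ?P) * (Q_factor N * alternate_signs (Q_factor N))"
    by (simp add: alternate_signs_mult mult_ac)
  then show ?case by (simp only: Suc Q_factor_alternate_signs mult_1)
qed

lemma mps_coeff_simps:
  "mps_coeff 0 m = 0"
  "mps_coeff (f + g) m = mps_coeff f m + mps_coeff g m"
  "mps_coeff (- f) m = - mps_coeff f m"
  "mps_coeff (f * g) m = (\<Sum>(p, q)\<in>mset_splits m. mps_coeff f p * mps_coeff g q)"
  by (simp_all add: zero_mps_def plus_mps_def uminus_mps_def times_mps_def)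

lemma mps_coeff_sum: "mps_coeff (\<Sum>i\<in>A. f i) m = (\<Sum>i\<in>A. mps_coeff (f i) m)"
  by (induction A rule: infinite_finite_induct) (simp_all add: mps_coeff_simps)

lemma mps_coeff_sign_mult: "mps_coeff ((-1) ^ i * f) m = (-1) ^ i * mps_coeff f m"
  for f :: "'a::comm_ring_1 mps"
  by (induction i) (simp_all add: mps_coeff_simps)

text \<open>
  The coefficients of $Q(t)\,Q(-t)=1$. The relation holds for every finite number of variables,
  and each coefficient of either side at a given monomial agrees with that of a finite product.
\<close>

lemma Q_fun_relation: "(\<Sum>i\<le>m. (-1) ^ i * (Q_fun i * Q_fun (m - i))) = (if m = 0 then 1 else 0)"
proof (rule mps_eqI)
  fix s :: "nat multiset"
  let ?P = "\<lambda>N. \<Prod>r<N. Q_factor r"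
  let ?splits = "fst ` mset_splits s \<union> snd ` mset_splits s"
  have "eventually (\<lambda>N. \<forall>i\<in>{..m}. \<forall>p\<in>?splits.
      mps_coeff (fps_nth (?P N) i) p = mps_coeff (Q_fun i) p) sequentially"
    by (intro eventually_ball_finite ballI eventually_Q_fun) auto
  then obtain N where N: "\<And>i p. i \<le> m \<Longrightarrow> p \<in> ?splits \<Longrightarrow>
      mps_coeff (fps_nth (?P N) i) p = mps_coeff (Q_fun i) p"
    unfolding eventually_sequentially by (meson atMost_iff order_refl)
  have "mps_coeff (Q_fun i * Q_fun (m - i)) s = mps_coeff (fps_nth (?P N) i
      * fps_nth (?P N) (m - i)) s"
    if "i \<le> m" for i
    unfolding mps_coeff_simps case_prod_beta using that by (intro sum.cong refl) (simp add: N)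
  then have "mps_coeff (\<Sum>i\<le>m. (-1) ^ i * (Q_fun i * Q_fun (m - i))) s =
      mps_coeff (\<Sum>i\<le>m. (-1) ^ i * (fps_nth (?P N) i * fps_nth (?P N) (m - i))) s"
    by (simp add: mps_coeff_sum mps_coeff_sign_mult)
  also have "(\<Sum>i\<le>m. (-1) ^ i * (fps_nth (?P N) i * fps_nth (?P N) (m - i))) =
      fps_nth (alternate_signs (?P N) * ?P N) m"
    by (simp add: fps_mult_nth alternate_signs_def atMost_atLeast0 mult.assoc)
  also have "\<dots> = (if m = 0 then 1 else 0)"
    using Q_partial_product_alternate_signs [of N] by (simp add: mult.commute)
  finally show "mps_coeff (\<Sum>i\<le>m. (-1) ^ i * (Q_fun i * Q_fun (m - i))) s =
      mps_coeff (if m = 0 then 1 else 0) s" .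
qed

lemma Q_fun_0 [simp]: "Q_fun 0 = 1"
proof (rule mps_eqI)
  fix m :: "nat multiset"
  have "fps_nth (Q_factor r) 0 = 1" for r
    by (simp add: Q_factor_def)
  then have 1: "fps_nth (\<Prod>r<N. Q_factor r) 0 = 1" for N
    by (induction N) simp_all
  obtain N where "mps_coeff (fps_nth (\<Prod>r<N. Q_factor r) 0) m = mps_coeff (Q_fun 0) m"
    using eventually_Q_fun [of 0 m] unfolding eventually_sequentially by blast
  then show "mps_coeff (Q_fun 0) m = mps_coeff 1 m" by (simp add: 1)
qed

text \<open>
  The alternating sum in the definition of $Q_{(k,l)}$ with all coefficients equal to one; up to
  sign it is the part $\sum_{i\le l}(-1)^iQ_iQ_{k+l-i}$ of the relation between the $Q_j$.
\<close>

definition Q_tail :: "nat \<Rightarrow> nat \<Rightarrow> int mps" where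
  "Q_tail k l = (\<Sum>p\<le>l. (-1) ^ p * (Q_fun (k + p) * Q_fun (l - p)))"

lemma Q_pair_Q_tail: "Q_pair k l = 2 * Q_tail k l - Q_fun k * Q_fun l"
proof -
  have "Q_tail k l = Q_fun k * Q_fun l + (\<Sum>p=1..l. (-1) ^ p * (Q_fun (k + p) * Q_fun (l - p)))"
    by (simp add: Q_tail_def atMost_atLeast0 sum.atLeast_Suc_atMost)
  then show ?thesis
    by (simp add: Q_pair_def algebra_simps)
qed

text \<open>
  The relation for $a+b+1$ splits into its terms with $i\le b$ and with $i>b$. These are the two
  sides, with opposite signs.
\<close>

lemma Q_tail_symmetric: "Q_tail (Suc a) b = Q_tail (Suc b) a"
proof -
  let ?t = "\<lambda>i. (-1) ^ i * (Q_fun i * Q_fun (b + Suc a - i))"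
  have "0 = (\<Sum>i\<le>b + Suc a. ?t i)"
    using Q_fun_relation [of "b + Suc a"] by simp
  also have "\<dots> = (\<Sum>i\<le>b. ?t i) + (\<Sum>i=Suc b..b + Suc a. ?t i)"
    by (rule sum_up_index_split)
  also have "(\<Sum>i\<le>b. ?t i) = (-1) ^ b * Q_tail (Suc a) b"
    unfolding Q_tail_def sum_distrib_left
  proof (rule sum.reindex_bij_witness [where i = "\<lambda>p. b - p" and j = "\<lambda>i. b - i"])
    fix i assume "i \<in> {..b}"
    then obtain p where b: "b = i + p" by (auto simp: le_iff_add)
    then have "Suc a + (b - i) = b + Suc a - i" "b - (b - i) = i" "b - i = p" by simp_all
    then show "(-1) ^ b * ((-1) ^ (b - i) * (Q_fun (Suc a + (b - i)) * Q_fun (b - (b - i)))) = ?t i"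
      by (simp only: b power_add mult.assoc left_minus_one_mult_self mult.commute [of "Q_fun i"])
  qed auto
  also have "(\<Sum>i=Suc b..b + Suc a. ?t i) = - ((-1) ^ b * Q_tail (Suc b) a)"
    unfolding Q_tail_def sum_distrib_left sum_negf [symmetric]
  proof (rule sum.reindex_bij_witness [where i = "\<lambda>p. Suc b + p" and j = "\<lambda>i. i - Suc b"])
    fix i assume "i \<in> {Suc b..b + Suc a}"
    then obtain p where i: "i = Suc b + p" by (auto simp: le_iff_add)
    show "- ((-1) ^ b * ((-1) ^ (i - Suc b) * (Q_fun (Suc b + (i - Suc b))
        * Q_fun (a - (i - Suc b))))) = ?t i"
      by (simp add: i power_add mult.assoc)
  qed auto
  finally have "(-1) ^ b * Q_tail (Suc a) b = (-1) ^ b * Q_tail (Suc b) a"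
    by (simp add: algebra_simps)
  then have "(-1) ^ b * ((-1) ^ b * Q_tail (Suc a) b) = (-1) ^ b * ((-1) ^ b * Q_tail (Suc b) a)"
    by simp
  then show ?thesis by (simp flip: mult.assoc power_add)
qed

lemma Q_tail_add:
  assumes "k + l > 0"
  shows "Q_tail k l + Q_tail l k = Q_fun k * Q_fun l"
proof -
  have *: "Q_tail (Suc a) l + Q_tail l (Suc a) = Q_fun (Suc a) * Q_fun l" for a l
  proof -
    have "Q_tail l (Suc a) = Q_fun l * Q_fun (Suc a) - Q_tail (Suc l) a"
      by (simp add: Q_tail_def sum.atMost_Suc_shift sum_negf del: sum.atMost_Suc)
    then show ?thesis by (simp add: Q_tail_symmetric mult.commute)
  qed
  show ?thesis
  proof (cases k)
    case 0
    then obtain b where "l = Suc b" using assms by (cases l) auto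
    then show ?thesis using * [of b k] by (simp add: add.commute mult.commute)
  qed (simp add: *)
qed

text \<open>
  The formula for $Q_{(k,l)}$ is antisymmetric in general but gives 1 at $(0,0)$.
\<close>

definition Q_kernel :: "nat \<Rightarrow> nat \<Rightarrow> int mps" where
  "Q_kernel k l = (if k = 0 \<and> l = 0 then 0 else Q_pair k l)"

lemma Q_kernel_Q_tail: "k + l > 0 \<Longrightarrow> Q_kernel k l = 2 * Q_tail k l - Q_fun k * Q_fun l"
  by (auto simp: Q_kernel_def Q_pair_Q_tail)

interpretation Q_kernel: antisymmetric_kernel Q_kernel
proof
  fix k l
  show "Q_kernel k l = - Q_kernel l k"
  proof (cases "k + l > 0")
    case True
    have "Q_kernel k l + Q_kernel l k = 2 * (Q_tail k l + Q_tail l k) - 2 * (Q_fun k * Q_fun l)"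
      using True by (simp add: Q_kernel_Q_tail algebra_simps)
    then have "Q_kernel k l + Q_kernel l k = 0"
      by (simp only: Q_tail_add [OF True]) simp
    then show ?thesis by (simp only: eq_neg_iff_add_eq_0)
  qed (simp add: Q_kernel_def)
  show "Q_kernel k k = 0"
  proof (cases "k = 0")
    case False
    then have "2 * Q_tail k k = Q_fun k * Q_fun k"
      using Q_tail_add [of k k] by (simp only: mult_2)
    then show ?thesis using False by (simp add: Q_kernel_Q_tail)
  qed (simp add: Q_kernel_def)
qed

lemma Q_kernel_0_right: "k > 0 \<Longrightarrow> Q_kernel k 0 = Q_fun k"
  by (simp add: Q_kernel_def Q_pair_def)

section \<open>The functions $Q_K$ as bordered Pfaffians\<close>

text \<open>
  The final zero that gives a list even length.
\<close>

definition pad :: "nat list \<Rightarrow> nat list" where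
  "pad L = (if even (length L) then L else L @ [0])"

text \<open>
  The kernel differs from $Q_{(k,l)}$ only at $(0,0)$, and only the last entry of the padded list
  can be 0.
\<close>

lemma Q_strict_pf:
  assumes "0 \<notin> set L"
  shows "Q_strict L = pf Q_kernel (pad L)"
proof -
  have "Q_strict L = pfaffian (length (pad L) div 2)
      (\<lambda>p q. if p < q then Q_pair (pad L ! p) (pad L ! q)
        else if q < p then - Q_pair (pad L ! q) (pad L ! p) else 0)"
    unfolding Q_strict_def Let_def pad_def ..
  also have "\<dots> = pfaffian (length (pad L) div 2) (\<lambda>p q. Q_kernel (pad L ! p) (pad L ! q))"
  proof (rule pfaffian_cong)
    fix p q assume pq: "p < q" "q < 2 * (length (pad L) div 2)"
    then have "p < length L" by (auto simp: pad_def split: if_splits)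
    then have "pad L ! p \<in> set L" by (simp add: pad_def nth_append)
    then have "pad L ! p \<noteq> 0" using assms by metis
    then show "(if p < q then Q_pair (pad L ! p) (pad L ! q)
        else if q < p then - Q_pair (pad L ! q) (pad L ! p) else 0) =
            Q_kernel (pad L ! p) (pad L ! q)"
      using pq by (simp add: Q_kernel_def)
  qed
  finally show ?thesis by (simp add: pf_def pad_def)
qed

text \<open>
  The permutation is well defined: it arranges the list in decreasing order, and in a distinct
  list the position of each entry of the result is determined.
\<close>

lemma sorting_perm_permutes:
  assumes "distinct K"
  shows "sorting_perm K permutes {..<length K}"
proof -
  let ?S = "\<lambda>w. w permutes {..<length K} \<and> (\<forall>j<length K. \<forall>i<j. K ! w i > K ! w j)"
  have sorted: "map (\<lambda>i. K ! w i) [0..<length K] = rev (sort K)" if "?S w" for w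
  proof -
    let ?L = "map (\<lambda>i. K ! w i) [0..<length K]"
    have "sorted_wrt (>) ?L" using that by (simp add: sorted_wrt_iff_nth_less)
    then have "sorted_wrt (<) (rev ?L)" by (simp only: sorted_wrt_rev)
    moreover have "mset ?L = mset K"
      using that mset_permute_list [of w K] by (simp add: permute_list_def)
    ultimately have "rev ?L = sort K"
      by (metis mset_rev properties_for_sort strict_sorted_imp_sorted)
    then show ?thesis by (metis rev_rev_ident)
  qed
  have "\<exists>!w. ?S w"
  proof (rule ex_ex1I)
    obtain w where w: "w permutes {..<length K}" "permute_list w K = rev (sort K)"
      using mset_eq_permutation [of "rev (sort K)" K] by auto
    have "sorted_wrt (\<ge>) (rev (sort K))" by (simp add: sorted_wrt_rev)
    moreover have "distinct (rev (sort K))" using assms by simp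
    ultimately have "sorted_wrt (>) (rev (sort K))"
      by (simp add: sorted_wrt_iff_nth_less distinct_conv_nth order_less_le)
    then have "sorted_wrt (>) (map (\<lambda>i. K ! w i) [0..<length K])"
      using w by (simp add: permute_list_def)
    then show "\<exists>w. ?S w" using w by (auto simp: sorted_wrt_iff_nth_less)
  next
    fix w w' assume w: "?S w" and w': "?S w'"
    have eq: "K ! w i = K ! w' i" if "i < length K" for i
      using sorted [OF w] sorted [OF w'] that by (metis (no_types, lifting) add_0 diff_zero
          length_upt nth_map nth_upt)
    show "w = w'"
    proof
      fix i
      show "w i = w' i"
      proof (cases "i < length K")
        case True
        then have "w i < length K" "w' i < length K"
          using w w' by (metis lessThan_iff permutes_in_image)+
        then show ?thesis using eq [OF True] assms by (simp add: nth_eq_iff_index_eq)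
      next
        case False
        then have "i \<notin> {..<length K}" by simp
        then show ?thesis
          using permutes_not_in [OF conjunct1 [OF w]] permutes_not_in [OF conjunct1 [OF w']] by simp
      qed
    qed
  qed
  from theI' [OF this] show ?thesis unfolding sorting_perm_def by blast
qed

lemma pf_pad_permute:
  assumes w: "w permutes {..<length L}"
  shows "pf Q_kernel (pad (map (\<lambda>i. L ! w i) [0..<length L])) = of_int (sign w)
      * pf Q_kernel (pad L)"
proof -
  have in_range: "w i < length L" if "i < length L" for i
    using permutes_in_image [OF w, of i] that by simp
  have "w permutes {..<length (pad L)}"
    by (rule permutes_subset [OF w]) (simp add: pad_def)
  moreover have "pad (map (\<lambda>i. L ! w i) [0..<length L]) = map (\<lambda>i. pad L ! w i) [0..<length (pad
      L)]"
    using in_range permutes_not_in [OF w, of "length L"] by (simp add: pad_def nth_append)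
  ultimately show ?thesis
    using Q_kernel.pf_permute by simp
qed

text \<open>
  The sign of the sorting permutation and the vanishing at repeated entries are those of the
  alternating Pfaffian.
\<close>

lemma sorted_Q_strict_pf:
  assumes "0 \<notin> set L"
  shows "(if distinct L then of_int (sign (sorting_perm L)) *
      Q_strict (map (\<lambda>i. L ! sorting_perm L i) [0..<length L]) else 0) = pf Q_kernel (pad L)"
proof (cases "distinct L")
  case True
  define w where "w = sorting_perm L"
  have w: "w permutes {..<length L}" unfolding w_def by (rule sorting_perm_permutes [OF True])
  have "L ! w i \<in> set L" if "i < length L" for i
    using permutes_in_image [OF w, of i] that by simp
  then have "0 \<notin> set (map (\<lambda>i. L ! w i) [0..<length L])"
    using assms by fastforce
  moreover have "(of_int (sign w) * of_int (sign w) :: int mps) = 1"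
    by (simp add: sign_def)
  ultimately show ?thesis
    using True by (simp add: Q_strict_pf pf_pad_permute [OF w] flip: w_def mult.assoc)
next
  case False
  then show ?thesis
    using Q_kernel.pf_not_distinct [of "pad L"] by (simp add: pad_def)
qed

text \<open>
  A border by the $Q_k$ amounts, up to sign, to an entry 0 in front of the list, except that
  $Q_0=1$ whereas the kernel vanishes at $(0,0)$.
\<close>

lemma wedge1_Q_fun:
  "wedge1 Q_fun (pf Q_kernel) L =
    - pf Q_kernel (0 # L) + wedge1 (\<lambda>k. if k = 0 then 1 else 0) (pf Q_kernel) L"
proof -
  have "Q_fun = (\<lambda>k. - Q_kernel 0 k + (if k = 0 then 1 else 0))"
  proof
    fix k
    show "Q_fun k = - Q_kernel 0 k + (if k = 0 then 1 else 0)"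
      using Q_kernel.antisym [of 0 k] Q_kernel.diag [of 0] by (simp add: Q_kernel_0_right)
  qed
  then have "wedge1 Q_fun (pf Q_kernel) L =
      wedge1 (\<lambda>k. - Q_kernel 0 k + (if k = 0 then 1 else 0)) (pf Q_kernel) L"
    by simp
  then show ?thesis
    by (simp only: wedge1_add wedge1_minus pf_Cons)
qed

text \<open>
  The case of odd length with final zero shows why the border is not simply a further entry 0:
  there $Q_K$ is the Pfaffian on the remaining entries, which comes from the correction at 0 in
  \<open>wedge1_Q_fun\<close>, while the list with two zeros contributes nothing.
\<close>

lemma Q_seq_bordered_pf:
  assumes "0 \<notin> set (butlast K)"
  shows "Q_seq K = bordered_pf Q_kernel Q_fun K"
proof (cases "K \<noteq> [] \<and> last K = 0")
  case True
  then obtain L where K: "K = L @ [0]" by (metis append_butlast_last_id)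
  with assms have pos: "0 \<notin> set L" by simp
  have "Q_seq K = pf Q_kernel (pad L)"
    using sorted_Q_strict_pf [OF pos] by (simp add: Q_seq_def drop_final_zero_def K Let_def)
  also have "\<dots> = bordered_pf Q_kernel Q_fun K"
  proof (cases "even (length L)")
    case True
    have "wedge1 (\<lambda>k. if k = 0 then 1 else 0) (pf Q_kernel) (L @ [0]) = pf Q_kernel L"
      using pos True by (subst wedge1_append_single) (auto intro!: gr0I)
    moreover have "pf Q_kernel (0 # L @ [0]) = 0"
      by (rule Q_kernel.pf_not_distinct) simp
    ultimately show ?thesis
      using True by (simp add: bordered_pf_def K wedge1_Q_fun pad_def pf_odd)
  next
    case False
    then show ?thesis by (simp add: bordered_pf_def K wedge1_pf_even pad_def)
  qed
  finally show ?thesis .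
next
  case False
  have pos: "0 \<notin> set K"
    using False assms by (cases K rule: rev_cases) auto
  have "drop_final_zero K = K" using False by (auto simp: drop_final_zero_def)
  then have "Q_seq K = pf Q_kernel (pad K)"
    using sorted_Q_strict_pf [OF pos] by (simp add: Q_seq_def Let_def)
  also have "\<dots> = bordered_pf Q_kernel Q_fun K"
  proof (cases "even (length K)")
    case True
    then show ?thesis by (simp add: bordered_pf_def wedge1_pf_even pad_def)
  next
    case False
    have "wedge1 (\<lambda>k. if k = 0 then 1 else 0) (pf Q_kernel) K = 0"
      using pos by (intro wedge1_eq_0) (auto intro!: gr0I)
    moreover have "pf Q_kernel (K @ [0]) = - pf Q_kernel (0 # K)"
      using Q_kernel.pf_move_front [of K 0 "[]"] False by simp
    ultimately show ?thesis
      using False by (simp add: bordered_pf_def wedge1_Q_fun pad_def pf_odd)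
  qed
  finally show ?thesis .
qed

lemma butlast_splice_nonzero:
  assumes "length X = length Y" and "0 \<notin> set X" and "0 \<notin> set (butlast Y)"
  shows "0 \<notin> set (butlast (splice X Y))"
  using assms by (induction X Y rule: list_induct2) (auto split: if_splits)

lemma butlast_nths_nonzero:
  assumes "0 \<notin> set (butlast L)"
  shows "0 \<notin> set (butlast (nths L I))"
proof (cases L rule: rev_cases)
  case (snoc xs x)
  then show ?thesis
    using assms set_nths_subset [of xs I] by (auto simp: nths_append nths_singleton butlast_append
        dest: in_set_butlastD)
qed simp

text \<open>
  Only the last entry of $Y$ may be 0, and it stays at the end when entries of $X$ are removed.
  Hence every $Q_K$ in the sum is a bordered Pfaffian.
\<close>

lemma sum_Q_seq_eq_pf:
  fixes X Y :: "nat list"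
  assumes len: "length X = length Y" and Y: "0 \<notin> set (butlast Y)"
  shows "(\<Sum>I\<in>Pow {..<length X}. Q_seq (nths (map Suc X) I)
      * Q_seq (interleave_minus (map Suc X) Y I)) =
    pf (cross_kernel (\<lambda>a b. 2 * Q_tail (Suc a) b)) (marked_splice X Y)"
proof -
  let ?A = "map Suc X"
  have "Q_seq (nths ?A I) = bordered_pf Q_kernel Q_fun (nths ?A I)" for I
    by (intro Q_seq_bordered_pf butlast_nths_nonzero) (auto dest: in_set_butlastD)
  moreover have "Q_seq (interleave_minus ?A Y I) = bordered_pf Q_kernel Q_fun (interleave_minus ?A
      Y I)" for I
    unfolding interleave_minus_def
    using len Y by (intro Q_seq_bordered_pf butlast_nths_nonzero butlast_splice_nonzero) auto
  ultimately have "(\<Sum>I\<in>Pow {..<length X}. Q_seq (nths ?A I) * Q_seq (interleave_minus ?A Y I)) =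
      pf (cross_kernel (\<lambda>a b. Q_kernel a b + Q_fun a * Q_fun b)) (marked_splice ?A Y)"
    using sum_bordered_pf_interleave_minus [OF Q_kernel.antisymmetric_kernel_axioms, of ?A Y
        Q_fun] len by simp
  also have "\<dots> = pf (cross_kernel (\<lambda>a b. Q_kernel (Suc a) b + Q_fun (Suc a)
      * Q_fun b)) (marked_splice X Y)"
    using pf_cross_kernel_map [OF len, of _ Suc id] by simp
  finally show ?thesis by (simp add: Q_kernel_Q_tail)
qed

section \<open>Frobenius coordinates and the symmetric form of both sums\<close>

lemma down_closed_eq_lessThan_card:
  fixes D :: "nat set"
  assumes fin: "finite D" and down: "\<And>i j. j \<in> D \<Longrightarrow> i < j \<Longrightarrow> i \<in> D"
  shows "D = {..<card D}"
proof (cases "D = {}")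
  case False
  have "i \<in> D \<longleftrightarrow> i < Suc (Max D)" for i
    using Max_in [OF fin False] Max_ge [OF fin, of i] down [of "Max D" i]
    by (auto simp: less_Suc_eq)
  then have "D = {..<Suc (Max D)}" by auto
  moreover from this have "card D = Suc (Max D)" using card_lessThan by metis
  ultimately show ?thesis by simp
qed simp

lemma diagonal_lessThan:
  assumes "is_partition \<mu>"
  shows "{i. (i, i) \<in> diagram \<mu>} = {..<diag_length \<mu>}"
  unfolding diag_length_def
proof (rule down_closed_eq_lessThan_card)
  show "finite {i. (i, i) \<in> diagram \<mu>}"
    by (rule finite_subset [of _ "{..<length \<mu>}"]) (auto simp: diagram_def)
next
  fix i j assume *: "j \<in> {i. (i, i) \<in> diagram \<mu>}" "i < j"
  have "\<mu> ! i \<ge> \<mu> ! j"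
    using assms * by (auto simp: is_partition_def diagram_def sorted_wrt_iff_nth_less)
  then show "i \<in> {i. (i, i) \<in> diagram \<mu>}" using * by (auto simp: diagram_def)
qed

text \<open>
  The diagram contains the square whose side is the length of the main diagonal.
\<close>

lemma durfee_square:
  assumes "is_partition \<mu>" and "i < diag_length \<mu>"
  shows "i < length \<mu>" and "diag_length \<mu> \<le> \<mu> ! i"
proof -
  let ?m = "diag_length \<mu> - 1"
  have "?m \<in> {i. (i, i) \<in> diagram \<mu>}"
    using assms by (simp only: diagonal_lessThan [OF assms(1)]) simp
  then have m: "?m < length \<mu>" "?m < \<mu> ! ?m" by (auto simp: diagram_def)
  then show i: "i < length \<mu>" using assms(2) by simp
  have "\<mu> ! i \<ge> \<mu> ! ?m"
    using assms m by (cases "i = ?m") (auto simp: is_partition_def sorted_wrt_iff_nth_less)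
  then show "diag_length \<mu> \<le> \<mu> ! i" using m by simp
qed

text \<open>
  Row $j$ of the Durfee square is long enough to leave a positive coordinate, except possibly in
  the last row; the same holds for columns.
\<close>

lemma butlast_frobenius_nonzero:
  assumes "\<And>j. j < n \<Longrightarrow> n \<le> f j"
  shows "0 \<notin> set (butlast (map (\<lambda>j. f j - (j + 1)) [0..<n]))"
proof
  assume "0 \<in> set (butlast (map (\<lambda>j. f j - (j + 1)) [0..<n]))"
  then obtain j where "j < n - 1" "f j - (j + 1) = 0"
    by (auto simp: in_set_conv_nth nth_butlast)
  moreover from this have "n \<le> f j" by (intro assms) simp
  ultimately show False by simp
qed

lemma butlast_frob_alpha: "is_partition \<mu> \<Longrightarrow> 0 \<notin> set (butlast (frob_alpha \<mu>))"
  unfolding frob_alpha_def by (intro butlast_frobenius_nonzero durfee_square)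

lemma butlast_frob_beta:
  assumes "is_partition \<mu>"
  shows "0 \<notin> set (butlast (frob_beta \<mu>))"
  unfolding frob_beta_def
proof (rule butlast_frobenius_nonzero)
  fix j assume "j < diag_length \<mu>"
  then have "{..<diag_length \<mu>} \<subseteq> {i. (i, j) \<in> diagram \<mu>}"
    using durfee_square [OF assms] by (fastforce simp: diagram_def)
  moreover have "finite {i. (i, j) \<in> diagram \<mu>}"
    by (rule finite_subset [of _ "{..<length \<mu>}"]) (auto simp: diagram_def)
  ultimately have "card {..<diag_length \<mu>} \<le> conj_part \<mu> j"
    unfolding conj_part_def by (intro card_mono)
  then show "diag_length \<mu> \<le> conj_part \<mu> j" by simp
qed

theorem proposition3:
  fixes \<mu> :: "nat list" and n :: nat and \<alpha> \<beta> A B C D :: "nat list"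
  assumes "is_partition \<mu>"
    and "n = diag_length \<mu>"
    and "\<alpha> = frob_alpha \<mu>" and "\<beta> = frob_beta \<mu>"
    and "A = map (\<lambda>a. a + 1) \<alpha>" and "B = \<beta>"
    and "C = map (\<lambda>b. b + 1) \<beta>" and "D = \<alpha>"
  shows "(\<Sum>I\<in>Pow {..<n}. Q_seq (nths A I) * Q_seq (interleave_minus A B I))
       = (\<Sum>I\<in>Pow {..<n}. Q_seq (nths C I) * Q_seq (interleave_minus C D I))"
proof -
  have len: "length \<alpha> = n" "length \<beta> = n"
    using assms by (simp_all add: frob_alpha_def frob_beta_def)
  have AC: "A = map Suc \<alpha>" "C = map Suc \<beta>"
    using assms by simp_all
  let ?E = "\<lambda>a b. 2 * Q_tail (Suc a) b"
  have "(\<Sum>I\<in>Pow {..<n}. Q_seq (nths A I) * Q_seq (interleave_minus A B I)) =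
      pf (cross_kernel ?E) (marked_splice \<alpha> \<beta>)"
    using sum_Q_seq_eq_pf [of \<alpha> \<beta>] butlast_frob_beta [OF assms(1)] assms len AC by simp
  also have "\<dots> = pf (cross_kernel (\<lambda>b a. ?E a b)) (marked_splice \<beta> \<alpha>)"
    by (rule pf_cross_kernel_transpose) (simp add: len)
  also have "(\<lambda>b a. ?E a b) = ?E"
    by (intro ext) (simp add: Q_tail_symmetric)
  also have "pf (cross_kernel ?E) (marked_splice \<beta> \<alpha>) =
      (\<Sum>I\<in>Pow {..<n}. Q_seq (nths C I) * Q_seq (interleave_minus C D I))"
    using sum_Q_seq_eq_pf [of \<beta> \<alpha>] butlast_frob_alpha [OF assms(1)] assms len AC by simp
  finally show ?thesis .
qed

end
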